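(* Let $l,m,n$ be integers with $0<l<m<n$. For $V\in G(n-l,m-l)$ write $\mathbb{V}=V\times\mathbb{R}^l\subset\mathbb{R}^n$ and, for $B\subset\mathbb{R}^n$, $B_{\mathbb{V}}=\pi_{\mathbb{V}}(B)$, where $\pi_{\mathbb{V}}\colon\mathbb{R}^n\to\mathbb{V}$ is the orthogonal projection. Let $B\subset\mathbb{R}^n$ be a bounded analytic set, and write $$\mathfrak{m}_{\mathrm{B}}:=\sup\{\overline{\dim}_{\mathrm{B}}B_{\mathbb{V}}: V\in G(n-l,m-l)\},\qquad \mathfrak{m}_{\mathbf{p}}:=\sup\{\dim_{\mathbf{p}}B_{\mathbb{V}}: V\in G(n-l,m-l)\}.$$ Then the sets $$E_{\mathrm{B}}:=\{V\in G(n-l,m-l):\overline{\dim}_{\mathrm{B}}B_{\mathbb{V}}\neq\mathfrak{m}_{\mathrm{B}}\},\qquad E_{\mathbf{p}}:=\{V\in G(n-l,m-l):\dim_{\mathbf{p}}B_{\mathbb{V}}\neq\mathfrak{m}_{\mathbf{p}}\}$$ are meagre in $G(n-l,m-l)$ and have $\gamma_{n-l,m-l}$ measure zero. Moreover, the statement concerning packing dimension (that $E_{\mathbf{p}}$ is meagre and $\gamma_{n-l,m-l}$-null) also holds for every unbounded analytic set $B\subset\mathbb{R}^n$.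
   Context: $G(d,k)$ is the Grassmannian of $k$-dimensional linear subspaces of $\mathbb{R}^d$, endowed with the metric $d_\pi(V,W)=\|\pi_V-\pi_W\|$ (operator norm of the difference of orthogonal projections), and $\gamma_{d,k}$ is the natural $O(d)$-invariant Borel probability measure on it. $\mathbb{R}^n$ is identified with $\mathbb{R}^{n-l}\times\mathbb{R}^l$, so $\mathbb{V}=V\times\mathbb{R}^l$ is an $m$-dimensional subspace of $\mathbb{R}^n$ containing $\{0\}\times\mathbb{R}^l$. For a bounded set $E$, $N(E,\delta)$ is the least number of closed balls of radius $\delta$ needed to cover $E$, and the upper box dimension is $\overline{\dim}_{\mathrm{B}}E=\limsup_{\delta\to0}\frac{\log N(E,\delta)}{-\log\delta}$. The packing dimension is $\dim_{\mathbf{p}}E=\inf\{\sup_j\overline{\dim}_{\mathrm{B}}F_j: E\subset\bigcup_{j\in\mathbb{N}}F_j\}$, where the $F_j$ are bounded sets. A set is meagre if it is a countable union of nowhere dense sets. *)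

theory Defs
  imports "HOL-Analysis.Analysis" "HOL-Probability.Probability_Measure"
begin

section \<open>Orthogonal projections and the Grassmannian\<close>

text \<open>
  The span makes the projection total in \<open>V\<close>; for a subspace \<open>V\<close> we have \<open>span V = V\<close>
  and this is the usual orthogonal projection onto \<open>V\<close>.
\<close>

definition orth_proj :: "'a::euclidean_space set \<Rightarrow> 'a \<Rightarrow> 'a" where
  "orth_proj V x = (THE y. y \<in> span V \<and> (\<forall>v\<in>V. orthogonal (x - y) v))"

definition grassmannian :: "nat \<Rightarrow> 'a::euclidean_space set set" where
  "grassmannian k = {V. subspace V \<and> dim V = k}"

definition grass_dist :: "'a::euclidean_space set \<Rightarrow> 'a set \<Rightarrow> real" where
  "grass_dist V W = onorm (\<lambda>x. orth_proj V x - orth_proj W x)"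

definition grass_topology :: "nat \<Rightarrow> 'a::euclidean_space set topology" where
  "grass_topology k = Metric_space.mtopology (grassmannian k) grass_dist"

lemma orth_proj_ex1:
  fixes x :: "'a::euclidean_space"
  shows "\<exists>!y. y \<in> span V \<and> (\<forall>v\<in>V. orthogonal (x - y) v)"
proof -
  obtain y z where yz: "y \<in> span V" "\<And>w. w \<in> span V \<Longrightarrow> orthogonal z w" "x = y + z"
    using orthogonal_subspace_decomp_exists[of V x] by metis
  show ?thesis
  proof (rule ex1I)
    show "y \<in> span V \<and> (\<forall>v\<in>V. orthogonal (x - y) v)"
      using yz by (auto intro: span_base)
  next
    fix u assume u: "u \<in> span V \<and> (\<forall>v\<in>V. orthogonal (x - u) v)"
    have "orthogonal (x - u) w" if "w \<in> span V" for w
      by (rule orthogonal_to_span[OF that]) (use u in auto)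
    then have "orthogonal (x - u) (y - u)"
      using u yz by (simp add: span_diff)
    moreover have "orthogonal (x - y) (y - u)"
      using u yz by (simp add: span_diff)
    ultimately have "(y - u) \<bullet> (y - u) = 0"
      by (simp add: orthogonal_def inner_diff_left inner_diff_right)
    then show "u = y" by simp
  qed
qed

lemma orth_proj_in_span: "orth_proj V x \<in> span V"
  and orth_proj_orthogonal: "v \<in> V \<Longrightarrow> orthogonal (x - orth_proj V x) v"
  using theI'[OF orth_proj_ex1[of V x]] unfolding orth_proj_def by blast+

lemma orth_proj_eqI:
  "y \<in> span V \<Longrightarrow> (\<And>v. v \<in> V \<Longrightarrow> orthogonal (x - y) v) \<Longrightarrow> orth_proj V x = y"
  using orth_proj_ex1[of V x] orth_proj_in_span orth_proj_orthogonal by blast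

lemma linear_orth_proj: "linear (orth_proj V)"
proof
  fix x y :: 'a and c :: real
  show "orth_proj V (x + y) = orth_proj V x + orth_proj V y"
    using orth_proj_orthogonal[of _ V x] orth_proj_orthogonal[of _ V y]
    by (intro orth_proj_eqI)
       (auto simp: orth_proj_in_span span_add orthogonal_def inner_diff_left inner_add_left)
  show "orth_proj V (c *\<^sub>R x) = c *\<^sub>R orth_proj V x"
    using orth_proj_orthogonal[of _ V x]
    by (intro orth_proj_eqI)
       (auto simp: orth_proj_in_span span_scale orthogonal_def inner_diff_left)
qed

lemma range_orth_proj: "range (orth_proj V) = span V"
proof
  show "span V \<subseteq> range (orth_proj V)"
  proof
    fix x assume "x \<in> span V"
    then have "orth_proj V x = x" by (intro orth_proj_eqI) (auto simp: orthogonal_def)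
    then show "x \<in> range (orth_proj V)" by (metis rangeI)
  qed
qed (auto simp: orth_proj_in_span)

lemma Metric_space_grassmannian: "Metric_space (grassmannian k) grass_dist"
proof
  have bl: "bounded_linear (\<lambda>x. orth_proj V x - orth_proj W x)" for V W :: "'a set"
    by (intro bounded_linear_sub linear_orth_proj[THEN linear_conv_bounded_linear[THEN iffD1]])
  fix U V W :: "'a set"
  show "0 \<le> grass_dist V W"
    unfolding grass_dist_def by (rule onorm_pos_le[OF bl])
  show "grass_dist V W = grass_dist W V"
    unfolding grass_dist_def by (subst onorm_neg[symmetric]) simp
  show "grass_dist V W = 0 \<longleftrightarrow> V = W" if "V \<in> grassmannian k" "W \<in> grassmannian k"
  proof
    assume "grass_dist V W = 0"
    then have "orth_proj V = orth_proj W"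
      unfolding grass_dist_def by (subst (asm) onorm_eq_0[OF bl]) auto
    then have "span V = span W"
      by (metis range_orth_proj)
    then show "V = W"
      using that by (metis (mono_tags, lifting) grassmannian_def mem_Collect_eq span_eq_iff)
  qed (simp add: grass_dist_def onorm_zero)
  show "grass_dist U W \<le> grass_dist U V + grass_dist V W"
    unfolding grass_dist_def using onorm_triangle[OF bl[of U V] bl[of V W]] by simp
qed

text \<open>
  The orthogonally invariant Borel probability measures on \<open>grassmannian k\<close>. The orthogonal
  group acts by \<open>V \<mapsto> g ` V\<close>. For \<open>k \<le> DIM('a)\<close> there is exactly one such
  measure: the natural measure \<open>\<gamma>\<close> on the Grassmannian.
\<close>

definition invariant_grass_measure :: "nat \<Rightarrow> 'a::euclidean_space set measure \<Rightarrow> bool" where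
  "invariant_grass_measure k \<gamma> \<longleftrightarrow>
     prob_space \<gamma> \<and>
     space \<gamma> = grassmannian k \<and>
     sets \<gamma> = sigma_sets (grassmannian k) {U. openin (grass_topology k) U} \<and>
     (\<forall>g. orthogonal_transformation g \<longrightarrow>
        (\<forall>A\<in>sets \<gamma>. emeasure \<gamma> ((\<lambda>V. g ` V) ` A) = emeasure \<gamma> A))"


section \<open>Meagre and analytic sets\<close>

definition nowhere_dense_in :: "'a topology \<Rightarrow> 'a set \<Rightarrow> bool" where
  "nowhere_dense_in X S \<longleftrightarrow> S \<subseteq> topspace X \<and> X interior_of (X closure_of S) = {}"

definition meagre_in :: "'a topology \<Rightarrow> 'a set \<Rightarrow> bool" where
  "meagre_in X S \<longleftrightarrow> (\<exists>\<N>. countable \<N> \<and> (\<forall>N\<in>\<N>. nowhere_dense_in X N) \<and> S = \<Union>\<N>)"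

text \<open>
  Analytic (Suslin) sets: the empty set and the continuous images of the Baire space, i.e. of
  \<open>nat \<Rightarrow> nat\<close> with the product of the discrete topologies, which is the topology that
  the library's type class instance puts on this type.
\<close>

definition analytic_set :: "'a::topological_space set \<Rightarrow> bool" where
  "analytic_set A \<longleftrightarrow> A = {} \<or> (\<exists>f :: (nat \<Rightarrow> nat) \<Rightarrow> 'a. continuous_on UNIV f \<and> A = range f)"


section \<open>Upper box dimension and packing dimension\<close>

text \<open>
  Only meaningful for sets that are covered by finitely many balls of radius \<open>\<delta>\<close>, in
  particular for bounded sets in Euclidean space.
\<close>

definition cover_number :: "'a::metric_space set \<Rightarrow> real \<Rightarrow> nat" where
  "cover_number E \<delta> = (LEAST N. \<exists>C. finite C \<and> card C = N \<and> E \<subseteq> (\<Union>c\<in>C. cball c \<delta>))"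

text \<open>
  Since \<open>ln 0 = 0\<close>, the empty set has upper box dimension \<open>0\<close> here.
\<close>

definition upper_box_dim :: "'a::metric_space set \<Rightarrow> ereal" where
  "upper_box_dim E =
     Limsup (at_right 0) (\<lambda>\<delta>. ereal (ln (real (cover_number E \<delta>)) / - ln \<delta>))"

definition packing_dim :: "'a::metric_space set \<Rightarrow> ereal" where
  "packing_dim E =
     Inf {(SUP j. upper_box_dim (F j)) | F :: nat \<Rightarrow> 'a set.
            (\<forall>j. bounded (F j)) \<and> E \<subseteq> (\<Union>j. F j)}"


section \<open>Projections to the subspaces \<open>V \<times> UNIV\<close> and exceptional sets\<close>

definition proj_image ::
    "('a::euclidean_space \<times> 'b::euclidean_space) set \<Rightarrow> 'a set \<Rightarrow> ('a \<times> 'b) set" where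
  "proj_image B V = orth_proj (V \<times> UNIV) ` B"

definition exceptional_set :: "nat \<Rightarrow> ('a::euclidean_space set \<Rightarrow> ereal) \<Rightarrow> 'a set set" where
  "exceptional_set k D = {V \<in> grassmannian k. D V \<noteq> (SUP W\<in>grassmannian k. D W)}"

end

theory Submission
  imports Defs "HOL-Real_Asymp.Real_Asymp"
begin

text \<open>
  Fix \<open>V0\<close> and a maximal set \<open>X \<subseteq> B\<close> whose projection along \<open>V0\<close> is \<open>\<delta>\<close>-separated. The probability
  that a random \<open>V\<close> projects \<open>a\<close> to length at most \<open>\<delta>\<close> is of order \<open>(\<delta> / norm a) ^ k\<close>, so the expected
  number of pairs of points of \<open>X\<close> that become \<open>\<delta>\<close>-close under the projection is of order
  \<open>card X * ln (1 / \<delta>)\<close>. If the projection along \<open>V\<close> needs only \<open>M\<close> balls, there are at least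
  \<open>(card X)\<^sup>2 / M\<close> such pairs; by Markov's inequality these \<open>V\<close> lie in a closed set of measure of order
  \<open>M * ln (1 / \<delta>) / card X\<close>. Letting \<open>\<delta>\<close> tend to zero along a sequence that realises the upper box
  dimension along \<open>V0\<close>, the \<open>V\<close> with smaller dimension are caught in countably many closed null sets.
  Closed null sets are nowhere dense because nonempty open sets have positive measure. The packing
  dimension reduces to the box dimension by a Baire category argument in the parametrising Baire space.
\<close>

section \<open>Orthogonal projections\<close>

text \<open>Only a logarithm is lost at each scale because two exponents agree. The coordinates in
  the \<open>UNIV\<close> factor survive every projection unchanged, so two points can become
  \<delta>-close along some \<open>V\<close> only if these coordinates differ by at most \<delta>.
  In such a slab, a set separated along \<open>V0\<close> has at most of order (r / \<delta>) ^ k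
  points whose first coordinate is within r of a given one. This cancels the probability (\<delta> /
  r) ^ k, so each dyadic distance costs a constant whatever the dimension of the \<open>UNIV\<close>
  factor. The remaining logarithm is beaten by \<delta> powr (t - s) for thresholds
  \<open>s < t\<close>.

  For the packing dimension a countable cover of the projection changes with \<open>V\<close>, while
  the pieces to which the box dimension result is applied must not. They are therefore cut out in
  the parameter space of \<open>B\<close>: it is completely metrizable, which \<open>B\<close> need
  not be, and every projection of \<open>B\<close> is a continuous image of it.\<close>

lemma orth_proj_diff: "orth_proj V (x - y) = orth_proj V x - orth_proj V y"
  by (rule linear_diff[OF linear_orth_proj])

lemma norm_orth_proj_Pythagoras:
  "(norm x)\<^sup>2 = (norm (orth_proj V x))\<^sup>2 + (norm (x - orth_proj V x))\<^sup>2"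
proof -
  have "orthogonal (x - orth_proj V x) (orth_proj V x)"
    using orthogonal_to_span[OF orth_proj_in_span] orth_proj_orthogonal by blast
  then show ?thesis
    using norm_add_Pythagorean[of "orth_proj V x" "x - orth_proj V x"]
    by (simp add: orthogonal_commute)
qed

lemma norm_orth_proj_le: "norm (orth_proj V x) \<le> norm x"
  by (rule power2_le_imp_le) (use norm_orth_proj_Pythagoras[of x V] in auto)

lemma inner_orth_proj: "v \<in> V \<Longrightarrow> orth_proj V x \<bullet> v = x \<bullet> v"
  using orth_proj_orthogonal[of v V x] by (simp add: orthogonal_def inner_diff_left)

lemma span_Times_UNIV:
  assumes "subspace V"
  shows "span (V \<times> (UNIV :: 'b::real_vector set)) = V \<times> UNIV"
  using assms by (simp add: span_eq_iff subspace_Times)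

lemma orth_proj_Times_UNIV:
  fixes a :: "'a::euclidean_space" and b :: "'b::euclidean_space"
  assumes V: "subspace V"
  shows "orth_proj (V \<times> UNIV) (a, b) = (orth_proj V a, b)"
proof (rule orth_proj_eqI)
  show "(orth_proj V a, b) \<in> span (V \<times> UNIV)"
    using orth_proj_in_span[of V a] span_eq_iff[THEN iffD2, OF V] by (simp add: span_Times_UNIV[OF V])
  show "orthogonal ((a, b) - (orth_proj V a, b)) v" if "v \<in> V \<times> UNIV" for v
    using that orth_proj_orthogonal[of _ V a] by (auto simp: orthogonal_def inner_Pair_0)
qed

lemma orth_proj_isometry_image:
  assumes g: "orthogonal_transformation g"
  shows "orth_proj (g ` V) (g x) = g (orth_proj V x)"
proof (rule orth_proj_eqI)
  have lin: "linear g" using g by (rule orthogonal_transformation_linear)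
  show "g (orth_proj V x) \<in> span (g ` V)"
    using orth_proj_in_span[of V x] by (simp add: span_linear_image[OF lin])
  show "orthogonal (g x - g (orth_proj V x)) v" if "v \<in> g ` V" for v
    using that orth_proj_orthogonal[of _ V x] orthogonal_orthogonal_transformation[OF g]
    by (auto simp: linear_diff[OF lin, symmetric])
qed

lemma dim_orthogonal_comp:
  fixes U :: "'a::euclidean_space set"
  assumes "subspace U"
  shows "dim (orthogonal_comp U) = DIM('a) - dim U"
proof -
  have "dim {y \<in> UNIV. \<forall>x\<in>U. orthogonal x y} + dim U = dim (UNIV :: 'a set)"
    using assms by (intro dim_subspace_orthogonal_to_vectors) auto
  moreover have "{y \<in> UNIV. \<forall>x\<in>U. orthogonal x y} = orthogonal_comp U"
    by (auto simp: orthogonal_comp_def orthogonal_commute)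
  ultimately show ?thesis by simp
qed

lemma diff_orth_proj_in_orthogonal_comp: "x - orth_proj V x \<in> orthogonal_comp V"
  using orth_proj_orthogonal[of _ V x] by (auto simp: orthogonal_comp_def orthogonal_commute)

text \<open>Glue an isometry from \<open>V\<close> onto \<open>W\<close> to one between the
  orthogonal complements; the two parts stay orthogonal, so Pythagoras gives a norm preserving map.
  This is the transitivity behind every use of invariance.\<close>

lemma orthogonal_transformation_image_subspace_exists:
  fixes V W :: "'a::euclidean_space set"
  assumes V: "subspace V" and W: "subspace W" and d: "dim V = dim W"
  obtains g where "orthogonal_transformation g" "g ` V = W"
proof -
  obtain f where f: "linear f" "f ` V = W" "\<And>x. x \<in> V \<Longrightarrow> norm (f x) = norm x"
    using isometries_subspaces[OF V W d] by metis
  obtain h where h: "linear h" "h ` orthogonal_comp V = orthogonal_comp W"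
    "\<And>x. x \<in> orthogonal_comp V \<Longrightarrow> norm (h x) = norm x"
    using isometries_subspaces[of "orthogonal_comp V" "orthogonal_comp W"] V W d
    by (metis subspace_orthogonal_comp dim_orthogonal_comp)
  define g where "g x = f (orth_proj V x) + h (x - orth_proj V x)" for x
  have inV: "orth_proj V x \<in> V" for x
    using orth_proj_in_span[of V x] span_eq_iff[THEN iffD2, OF V] by simp
  note inVc = diff_orth_proj_in_orthogonal_comp[of _ V]
  have "linear g"
    unfolding g_def
    by (intro linear_compose_add linear_compose[OF linear_orth_proj f(1), unfolded o_def]
        linear_compose[OF _ h(1), unfolded o_def] linear_compose_sub linear_orth_proj linear_id[unfolded id_def])
  moreover have "norm (g x) = norm x" for x
  proof -
    have "f (orth_proj V x) \<in> W" "h (x - orth_proj V x) \<in> orthogonal_comp W"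
      using inV inVc f h by blast+
    then have "orthogonal (f (orth_proj V x)) (h (x - orth_proj V x))"
      by (auto simp: orthogonal_comp_def orthogonal_commute)
    then have "(norm (g x))\<^sup>2 = (norm (orth_proj V x))\<^sup>2 + (norm (x - orth_proj V x))\<^sup>2"
      unfolding g_def by (subst norm_add_Pythagorean) (auto simp: f(3)[OF inV] h(3)[OF inVc])
    then show ?thesis by (simp flip: norm_orth_proj_Pythagoras)
  qed
  ultimately have "orthogonal_transformation g" by (simp add: orthogonal_transformation)
  moreover have "g x = f x" if "x \<in> V" for x
  proof -
    have "orth_proj V x = x"
      using that by (intro orth_proj_eqI) (auto simp: span_base orthogonal_def)
    then show ?thesis by (simp add: g_def linear_0[OF h(1)])
  qed
  then have "g ` V = W" using f(2) by (metis image_cong)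
  ultimately show thesis by (rule that)
qed

lemma grassmannian_isometry_image:
  assumes "orthogonal_transformation g" "V \<in> grassmannian k"
  shows "g ` V \<in> grassmannian k"
proof -
  have "linear g" "inj g"
    using assms by (auto simp: orthogonal_transformation_linear orthogonal_transformation_inj)
  moreover from this have "dim (g ` V) = dim V"
    by (intro dim_image_eq) (auto intro: inj_on_subset)
  ultimately show ?thesis
    using assms by (simp add: grassmannian_def linear_subspace_image)
qed

section \<open>Orthonormal bases adapted to a subspace\<close>

lemma grassmannian_orthonormal_basis:
  assumes "V \<in> grassmannian k"
  obtains O' where "finite O'" "card O' = k" "O' \<subseteq> V" "pairwise orthogonal O'"
    "\<And>u. u \<in> O' \<Longrightarrow> norm u = 1" "span O' = V"
proof -
  have V: "subspace V" "dim V = k" using assms by (auto simp: grassmannian_def)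
  obtain O' where "O' \<subseteq> V" "pairwise orthogonal O'" "\<And>x. x \<in> O' \<Longrightarrow> norm x = 1"
    "independent O'" "card O' = dim V" "span O' = V"
    using orthonormal_basis_subspace[OF V(1)] by metis
  then show thesis using V by (intro that[of O']) (auto simp: independent_imp_finite)
qed

text \<open>In these coordinates a bounded piece of a thin neighbourhood of the orthogonal
  complement of \<open>V\<close> fits into a box, short in the \<open>k\<close> directions
  \<open>O1\<close> and long in the directions \<open>O2\<close>.\<close>

lemma grassmannian_adapted_basis:
  assumes V: "V \<in> grassmannian k"
  obtains O1 O2 :: "'a::euclidean_space set" where "finite O1" "finite O2" "card O1 = k"
    "card O2 = DIM('a) - k" "O1 \<inter> O2 = {}" "O1 \<subseteq> V" "pairwise orthogonal (O1 \<union> O2)"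
    "\<And>u. u \<in> O1 \<union> O2 \<Longrightarrow> norm u = 1" "span (O1 \<union> O2) = UNIV"
proof -
  have dim: "subspace V" "dim V = k" using V by (auto simp: grassmannian_def)
  obtain O1 where O1: "finite O1" "card O1 = k" "O1 \<subseteq> V" "pairwise orthogonal O1"
    "\<And>u. u \<in> O1 \<Longrightarrow> norm u = 1" "span O1 = V"
    by (rule grassmannian_orthonormal_basis[OF V]) metis
  have "orthogonal_comp V \<in> grassmannian (DIM('a) - k)"
    using dim by (simp add: grassmannian_def subspace_orthogonal_comp dim_orthogonal_comp)
  then obtain O2 where O2: "finite O2" "card O2 = DIM('a) - k" "O2 \<subseteq> orthogonal_comp V"
    "pairwise orthogonal O2" "\<And>u. u \<in> O2 \<Longrightarrow> norm u = 1" "span O2 = orthogonal_comp V"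
    by (rule grassmannian_orthonormal_basis) metis
  have orth: "orthogonal u v" if "u \<in> O1" "v \<in> O2" for u v
    using that O1(3) O2(3) by (auto simp: orthogonal_comp_def)
  show thesis
  proof (rule that[OF O1(1) O2(1) O1(2) O2(2) _ O1(3)])
    show "O1 \<inter> O2 = {}"
      using orth O1(5) by (metis disjoint_iff norm_zero orthogonal_self zero_neq_one)
    show "pairwise orthogonal (O1 \<union> O2)"
      using O1(4) O2(4) orth unfolding pairwise_def by (metis Un_iff orthogonal_commute)
    show "norm u = 1" if "u \<in> O1 \<union> O2" for u using that O1 O2 by auto
    have "x \<in> span (O1 \<union> O2)" for x
    proof -
      have "orth_proj V x \<in> span O1" "x - orth_proj V x \<in> span O2"
        using orth_proj_in_span[of V x] O1(6) O2(6) diff_orth_proj_in_orthogonal_comp[of x V]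
        by (metis span_span, simp)
      then have "orth_proj V x + (x - orth_proj V x) \<in> span (O1 \<union> O2)"
        by (intro span_add) (auto intro: subsetD[OF span_mono])
      then show ?thesis by simp
    qed
    then show "span (O1 \<union> O2) = UNIV" by auto
  qed
qed

text \<open>Used in the contrapositive: among q orthonormal coordinates of a vector of length at
  least \<delta>, one has size at least \<delta> / q. This explains the cell sides \<theta> / p and
  \<delta> / q below.\<close>

lemma norm_le_sum_abs_inner_orthonormal:
  assumes "finite U" "pairwise orthogonal U" "\<And>u. u \<in> U \<Longrightarrow> norm u = 1" "x \<in> span U"
  shows "norm x \<le> (\<Sum>u\<in>U. \<bar>x \<bullet> u\<bar>)"
proof -
  have "norm x = norm (\<Sum>u\<in>U. (x \<bullet> u) *\<^sub>R u)"
    using orthonormal_basis_expand[OF assms(2,3,4,1)] by simp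
  also have "\<dots> \<le> (\<Sum>u\<in>U. \<bar>x \<bullet> u\<bar>)"
    using assms(3) by (intro sum_norm_le) simp
  finally show ?thesis .
qed


section \<open>The topology of the Grassmannian\<close>

lemma topspace_grass_topology: "topspace (grass_topology k) = grassmannian k"
  unfolding grass_topology_def
  by (rule Metric_space.topspace_mtopology[OF Metric_space_grassmannian])

lemma bounded_linear_orth_proj_diff: "bounded_linear (\<lambda>x. orth_proj V x - orth_proj W x)"
  by (intro bounded_linear_sub linear_orth_proj[THEN linear_conv_bounded_linear[THEN iffD1]])

lemma norm_orth_proj_diff_le:
  "norm (orth_proj V x - orth_proj W x) \<le> grass_dist V W * norm x"
  unfolding grass_dist_def by (rule onorm[OF bounded_linear_orth_proj_diff])

text \<open>By definition of the operator norm, \<open>norm (orth_proj V a)\<close> is Lipschitz in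
  \<open>V\<close> with constant \<open>norm a\<close>.\<close>

lemma closedin_orth_proj_le:
  "closedin (grass_topology k) {V \<in> grassmannian k. norm (orth_proj V a) \<le> r}"
proof -
  interpret Metric_space "grassmannian k" grass_dist by (rule Metric_space_grassmannian)
  have "\<exists>e>0. \<forall>W. W \<in> mball V e \<longrightarrow> \<not> norm (orth_proj W a) \<le> r"
    if V: "V \<in> grassmannian k" "\<not> norm (orth_proj V a) \<le> r" for V
  proof (intro exI conjI allI impI)
    \<comment> \<open>The gap divided by the Lipschitz constant; the 1 keeps the denominator
      positive when \<open>a = 0\<close>.\<close>
    let ?e = "(norm (orth_proj V a) - r) / (norm a + 1)"
    show "?e > 0" using V by (intro divide_pos_pos) (auto intro: add_nonneg_pos)
    fix W assume "W \<in> mball V ?e"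
    then have "grass_dist V W * (norm a + 1) < norm (orth_proj V a) - r"
      by (subst (asm) in_mball) (simp add: pos_less_divide_eq add_nonneg_pos)
    moreover have "grass_dist V W * norm a \<le> grass_dist V W * (norm a + 1)"
      by (intro mult_left_mono) auto
    moreover have "norm (orth_proj V a) - norm (orth_proj W a) \<le> grass_dist V W * norm a"
      using norm_orth_proj_diff_le[of V a W] norm_triangle_ineq2[of "orth_proj V a" "orth_proj W a"]
      by linarith
    ultimately show "\<not> norm (orth_proj W a) \<le> r" by linarith
  qed
  then show ?thesis
    unfolding grass_topology_def closedin_metric by (auto simp: disjnt_iff) (metis in_mball)+
qed

text \<open>The count reaches \<open>t\<close> iff all conditions of some \<open>J\<close> with at
  least \<open>t\<close> elements hold, which makes the set a finite union of finite
  intersections.\<close>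

lemma closedin_card_ge:
  assumes "finite I" and A: "\<And>i. i \<in> I \<Longrightarrow> closedin X {x \<in> topspace X. P i x}"
  shows "closedin X {x \<in> topspace X. t \<le> real (card {i \<in> I. P i x})}"
proof -
  have "{x \<in> topspace X. t \<le> real (card {i \<in> I. P i x})} =
        (\<Union>J\<in>{J. J \<subseteq> I \<and> t \<le> real (card J)}. {x \<in> topspace X. \<forall>i\<in>J. P i x})" (is "?L = ?R")
  proof
    show "?L \<subseteq> ?R"
      by clarsimp (metis (mono_tags, lifting) mem_Collect_eq subsetI)
    show "?R \<subseteq> ?L"
    proof clarify
      fix x J assume J: "J \<subseteq> I" "t \<le> real (card J)" "\<forall>i\<in>J. P i x"
      then have "card J \<le> card {i \<in> I. P i x}"
        using \<open>finite I\<close> by (intro card_mono) auto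
      then show "t \<le> real (card {i \<in> I. P i x})" using J by linarith
    qed
  qed
  moreover have "closedin X {x \<in> topspace X. \<forall>i\<in>J. P i x}" if "J \<subseteq> I" for J
  proof (cases "J = {}")
    case False
    then have "{x \<in> topspace X. \<forall>i\<in>J. P i x} = (\<Inter>i\<in>J. {x \<in> topspace X. P i x})" by auto
    then show ?thesis using False that A by (auto intro!: closedin_Inter)
  qed auto
  ultimately show ?thesis
    using \<open>finite I\<close> by (auto intro!: closedin_Union)
qed

text \<open>Total boundedness: the matrix entries of a projection lie in [-1, 1], so after rounding
  to mesh \<open>h\<close> only finitely many patterns occur, and one subspace per pattern is
  enough.\<close>

lemma grassmannian_finite_cover:
  assumes "e > 0"
  shows "\<exists>F. finite F \<and> F \<subseteq> (grassmannian k :: 'a::euclidean_space set set) \<and>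
    (\<forall>V\<in>grassmannian k. \<exists>W\<in>F. grass_dist W V < e)"
proof -
  define d where "d = real DIM('a)"
  have "d > 0" by (simp add: d_def)
  \<comment> \<open>Entries that agree up to \<open>h\<close> give operator norm at most
    \<open>d * d * h\<close>; the 1 makes this strictly less than \<open>e\<close>.\<close>
  define h where "h = e / (d * d + 1)"
  have "h > 0" using \<open>e > 0\<close> \<open>d > 0\<close> by (simp add: h_def add_pos_pos)
  define \<phi> where "\<phi> V = (\<lambda>(i, j)\<in>Basis \<times> Basis. \<lfloor>orth_proj V i \<bullet> j / h\<rfloor>)" for V :: "'a set"
  have "\<phi> V \<in> PiE (Basis \<times> Basis) (\<lambda>_. {\<lfloor>- 1 / h\<rfloor>..\<lfloor>1 / h\<rfloor>})" for V
  proof -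
    have "\<lfloor>orth_proj V i \<bullet> j / h\<rfloor> \<in> {\<lfloor>- 1 / h\<rfloor>..\<lfloor>1 / h\<rfloor>}" if "i \<in> Basis" "j \<in> Basis" for i j
    proof -
      have "\<bar>orth_proj V i \<bullet> j\<bar> \<le> 1"
        using Basis_le_norm[OF that(2), of "orth_proj V i"] norm_orth_proj_le[of V i] that by simp
      then have "- 1 / h \<le> orth_proj V i \<bullet> j / h" "orth_proj V i \<bullet> j / h \<le> 1 / h"
        using \<open>h > 0\<close> by (intro divide_right_mono; simp)+
      then show ?thesis by (simp only: atLeastAtMost_iff floor_mono)
    qed
    then show ?thesis unfolding \<phi>_def by (auto simp: PiE_iff)
  qed
  then have "\<phi> ` grassmannian k \<subseteq> PiE (Basis \<times> Basis) (\<lambda>_. {\<lfloor>- 1 / h\<rfloor>..\<lfloor>1 / h\<rfloor>})" by blast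
  then have "finite (\<phi> ` grassmannian k)"
    by (rule finite_subset) (simp add: finite_PiE)
  then obtain F where F: "F \<subseteq> grassmannian k" "finite F" "\<phi> ` F = \<phi> ` grassmannian k"
    by (metis finite_subset_image subset_refl)
  show ?thesis
  proof (intro exI[of _ F] conjI ballI F(1,2))
    fix V :: "'a set" assume "V \<in> grassmannian k"
    then obtain W where W: "W \<in> F" "\<phi> W = \<phi> V" using F(3) by (metis imageE imageI)
    have coord: "\<bar>(orth_proj W i - orth_proj V i) \<bullet> j\<bar> \<le> h" if "i \<in> Basis" "j \<in> Basis" for i j
    proof -
      have "\<lfloor>orth_proj W i \<bullet> j / h\<rfloor> = \<lfloor>orth_proj V i \<bullet> j / h\<rfloor>"
        using fun_cong[OF W(2), of "(i, j)"] that by (simp add: \<phi>_def)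
      then have "\<bar>orth_proj W i \<bullet> j / h - orth_proj V i \<bullet> j / h\<bar> \<le> 1" by linarith
      then show ?thesis
        using \<open>h > 0\<close>
        by (simp add: inner_diff_left diff_divide_distrib[symmetric] abs_div_pos[symmetric] divide_le_eq)
    qed
    have "grass_dist W V \<le> d * d * h"
      unfolding grass_dist_def
    proof (rule onorm_le)
      fix x :: 'a
      let ?D = "\<lambda>x. orth_proj W x - orth_proj V x"
      have nb: "norm (?D i) \<le> d * h" if "i \<in> Basis" for i
        using norm_le_l1[of "?D i"] sum_bounded_above[of Basis "\<lambda>j. \<bar>?D i \<bullet> j\<bar>" h] coord[OF that]
        by (simp add: d_def)
      have "?D x = ?D (\<Sum>i\<in>Basis. (x \<bullet> i) *\<^sub>R i)" by (simp add: euclidean_representation)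
      also have "\<dots> = (\<Sum>i\<in>Basis. (x \<bullet> i) *\<^sub>R ?D i)"
        by (simp add: linear_sum[OF linear_orth_proj] linear_scale[OF linear_orth_proj]
            sum_subtractf scaleR_diff_right)
      also have "norm \<dots> \<le> (\<Sum>i\<in>(Basis::'a set). norm x * (d * h))"
      proof (rule sum_norm_le)
        fix i :: 'a assume i: "i \<in> Basis"
        show "norm ((x \<bullet> i) *\<^sub>R ?D i) \<le> norm x * (d * h)"
          using Basis_le_norm[OF i, of x] nb[OF i] by (simp add: mult_mono)
      qed
      finally show "norm (?D x) \<le> d * d * h * norm x" by (simp add: d_def mult_ac)
    qed
    also have "\<dots> < e"
      using \<open>e > 0\<close> add_pos_pos[OF mult_pos_pos[OF \<open>d > 0\<close> \<open>d > 0\<close>] zero_less_one]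
      by (simp add: h_def pos_divide_less_eq algebra_simps)
    finally show "\<exists>W\<in>F. grass_dist W V < e" using W by blast
  qed
qed

text \<open>One inequality suffices, applied to \<open>g\<close> and to its inverse.\<close>

lemma grass_dist_isometry_image:
  assumes g: "orthogonal_transformation (g :: 'a::euclidean_space \<Rightarrow> 'a)"
  shows "grass_dist (g ` V) (g ` W) = grass_dist V W"
proof -
  have "grass_dist (h ` V) (h ` W) \<le> grass_dist V W" if h: "orthogonal_transformation h"
    for h :: "'a \<Rightarrow> 'a" and V W
    unfolding grass_dist_def[of "h ` V"]
  proof (rule onorm_le)
    fix x
    obtain y where x: "x = h y" using orthogonal_transformation_surj[OF h] by (metis surjD)
    show "norm (orth_proj (h ` V) x - orth_proj (h ` W) x) \<le> grass_dist V W * norm x"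
      using norm_orth_proj_diff_le[of V y W] orthogonal_transformation_norm[OF h]
      unfolding x orth_proj_isometry_image[OF h]
      by (metis h linear_diff orthogonal_transformation_linear)
  qed
  from this[OF g, of V W] this[OF orthogonal_transformation_inv[OF g], of "g ` V" "g ` W"]
  show ?thesis
    using orthogonal_transformation_inj[OF g] by (simp add: image_inv_f_f)
qed


section \<open>Counting\<close>

text \<open>Rounding the coordinates to cells of side \<open>h\<close> is injective on
  \<open>S\<close>, so it is enough to count cells. The radius may depend on the coordinate because
  the sets to be counted are long in some directions and thin in others.\<close>

lemma card_separated_coordinates_le:
  fixes c :: "'i \<Rightarrow> 'x \<Rightarrow> real"
  assumes I: "finite I" and h: "h > 0" and R: "\<And>i. i \<in> I \<Longrightarrow> R i \<ge> 0"
    and bound: "\<And>x i. x \<in> S \<Longrightarrow> i \<in> I \<Longrightarrow> \<bar>c i x\<bar> \<le> R i"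
    and sep: "\<And>x y. x \<in> S \<Longrightarrow> y \<in> S \<Longrightarrow> x \<noteq> y \<Longrightarrow> \<exists>i\<in>I. h \<le> \<bar>c i x - c i y\<bar>"
  shows "finite S" and "real (card S) \<le> (\<Prod>i\<in>I. 2 * R i / h + 2)"
proof -
  define \<phi> where "\<phi> x = (\<lambda>i\<in>I. \<lfloor>c i x / h\<rfloor>)" for x
  let ?P = "PiE I (\<lambda>i. {\<lfloor>- R i / h\<rfloor>..\<lfloor>R i / h\<rfloor>})"
  have inj: "inj_on \<phi> S"
  proof (rule inj_onI, rule ccontr)
    fix x y assume xy: "x \<in> S" "y \<in> S" "\<phi> x = \<phi> y" "x \<noteq> y"
    from sep[OF xy(1,2,4)] obtain i where i: "i \<in> I" "h \<le> \<bar>c i x - c i y\<bar>" by blast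
    then have "\<lfloor>c i x / h\<rfloor> = \<lfloor>c i y / h\<rfloor>"
      using fun_cong[OF xy(3), of i] by (simp add: \<phi>_def)
    then have "\<bar>c i x / h - c i y / h\<bar> < 1" by linarith
    then show False
      using i h by (simp add: diff_divide_distrib[symmetric] abs_div_pos[symmetric] divide_less_eq)
  qed
  have "\<phi> x \<in> ?P" if x: "x \<in> S" for x
  proof -
    have "\<lfloor>c i x / h\<rfloor> \<in> {\<lfloor>- R i / h\<rfloor>..\<lfloor>R i / h\<rfloor>}" if "i \<in> I" for i
    proof -
      have "- R i / h \<le> c i x / h" "c i x / h \<le> R i / h"
        using bound[OF x that] h by (intro divide_right_mono; linarith)+
      then show ?thesis by (simp only: atLeastAtMost_iff floor_mono)
    qed
    then show ?thesis by (auto simp: \<phi>_def PiE_iff)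
  qed
  then have sub: "\<phi> ` S \<subseteq> ?P" by blast
  have fin: "finite ?P" using I by (intro finite_PiE) auto
  show "finite S" using finite_imageD[OF finite_subset[OF sub fin] inj] .
  have "card S = card (\<phi> ` S)" by (simp add: card_image inj)
  also have "\<dots> \<le> card ?P" by (rule card_mono[OF fin sub])
  also have "\<dots> = (\<Prod>i\<in>I. card {\<lfloor>- R i / h\<rfloor>..\<lfloor>R i / h\<rfloor>})" using I by (rule card_PiE)
  finally have "real (card S) \<le> (\<Prod>i\<in>I. real (card {\<lfloor>- R i / h\<rfloor>..\<lfloor>R i / h\<rfloor>}))"
    by (metis of_nat_le_iff of_nat_prod)
  \<comment> \<open>The two floors together lose at most 1, and counting both end points adds
    another 1.\<close>
  also have "\<dots> \<le> (\<Prod>i\<in>I. 2 * R i / h + 2)"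
  proof (rule prod_mono)
    fix i assume i: "i \<in> I"
    have "R i / h \<ge> 0" using R[OF i] h by simp
    then have "real (card {\<lfloor>- R i / h\<rfloor>..\<lfloor>R i / h\<rfloor>}) \<le> 2 * (R i / h) + 2"
      unfolding card_atLeastAtMost_int minus_divide_left[symmetric] by linarith
    then show "0 \<le> real (card {\<lfloor>- R i / h\<rfloor>..\<lfloor>R i / h\<rfloor>}) \<and>
      real (card {\<lfloor>- R i / h\<rfloor>..\<lfloor>R i / h\<rfloor>}) \<le> 2 * R i / h + 2" by simp
  qed
  finally show "real (card S) \<le> (\<Prod>i\<in>I. 2 * R i / h + 2)" .
qed

section \<open>Expected number of events that occur\<close>

lemma (in prob_space) expectation_card:
  assumes I: "finite I" and A: "\<And>i. i \<in> I \<Longrightarrow> A i \<in> events"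
  shows "integrable M (\<lambda>x. real (card {i \<in> I. x \<in> A i}))" (is ?int)
    and "expectation (\<lambda>x. real (card {i \<in> I. x \<in> A i})) = (\<Sum>i\<in>I. prob (A i))" (is ?exp)
proof -
  have eq: "real (card {i \<in> I. x \<in> A i}) = (\<Sum>i\<in>I. indicator (A i) x)" for x
    using I by (simp add: indicator_def sum.If_cases Int_def)
  have int: "integrable M (\<lambda>x. indicator (A i) x :: real)" if "i \<in> I" for i
    using A[OF that] by (simp add: less_top[symmetric])
  show ?int unfolding eq using int by simp
  show ?exp unfolding eq using int A by simp
qed

text \<open>Double counting: the sum is the expected number of events that occur. It turns a count
  of grid points for each fixed \<open>V\<close> into a bound on probabilities.\<close>

lemma (in prob_space) sum_prob_le_of_card_le:
  assumes "finite I" "\<And>i. i \<in> I \<Longrightarrow> A i \<in> events"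
    and "\<And>x. x \<in> space M \<Longrightarrow> real (card {i \<in> I. x \<in> A i}) \<le> c"
  shows "(\<Sum>i\<in>I. prob (A i)) \<le> c"
  using integral_le_const[OF expectation_card(1)[of I A, OF assms(1,2)], of c]
    expectation_card(2)[of I A, OF assms(1,2)] assms(3) by simp

lemma (in prob_space) prob_card_ge_le:
  assumes "finite I" "\<And>i. i \<in> I \<Longrightarrow> A i \<in> events" and "t > 0"
  shows "prob {x \<in> space M. t \<le> real (card {i \<in> I. x \<in> A i})} \<le> (\<Sum>i\<in>I. prob (A i)) / t"
  using integral_Markov_inequality_measure[OF expectation_card(1)[of I A, OF assms(1,2)] sets.top _ assms(3)]
    expectation_card(2)[of I A, OF assms(1,2)] by simp


section \<open>Invariant measures on the Grassmannian\<close>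

locale grassmannian_measure =
  fixes k :: nat and \<gamma> :: "'a::euclidean_space set measure"
  assumes invariant: "invariant_grass_measure k \<gamma>"
begin

sublocale prob_space \<gamma>
  using invariant by (simp add: invariant_grass_measure_def)

lemma space_eq: "space \<gamma> = grassmannian k"
  using invariant by (simp add: invariant_grass_measure_def)

lemma sets_eq: "sets \<gamma> = sigma_sets (grassmannian k) {U. openin (grass_topology k) U}"
  using invariant by (simp add: invariant_grass_measure_def)

lemma open_in_sets: "openin (grass_topology k) U \<Longrightarrow> U \<in> sets \<gamma>"
  by (simp add: sets_eq)

lemma closed_in_sets: "closedin (grass_topology k) A \<Longrightarrow> A \<in> sets \<gamma>"
proof -
  assume A: "closedin (grass_topology k) A"
  then have "openin (grass_topology k) (grassmannian k - A)" "A \<subseteq> grassmannian k"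
    by (auto simp: closedin_def topspace_grass_topology)
  then show ?thesis
    by (metis Diff_Diff_Int inf.absorb_iff2 open_in_sets sets.compl_sets space_eq)
qed

lemma emeasure_isometry_image:
  "orthogonal_transformation g \<Longrightarrow> A \<in> sets \<gamma> \<Longrightarrow> emeasure \<gamma> ((\<lambda>V. g ` V) ` A) = emeasure \<gamma> A"
  using invariant by (simp add: invariant_grass_measure_def)

section \<open>Subspaces nearly orthogonal to a given vector\<close>

definition small_proj :: "'a \<Rightarrow> real \<Rightarrow> 'a set set" where
  "small_proj a r = {V \<in> grassmannian k. norm (orth_proj V a) \<le> r}"

lemma closedin_small_proj: "closedin (grass_topology k) (small_proj a r)"
  unfolding small_proj_def by (rule closedin_orth_proj_le)

lemma small_proj_in_sets: "small_proj a r \<in> sets \<gamma>"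
  by (rule closed_in_sets[OF closedin_small_proj])

lemma small_proj_scaleR: "c > 0 \<Longrightarrow> small_proj (c *\<^sub>R a) (c * r) = small_proj a r"
  by (simp add: small_proj_def linear_scale[OF linear_orth_proj])

lemma small_proj_isometry_image:
  assumes g: "orthogonal_transformation g"
  shows "(\<lambda>V. g ` V) ` small_proj a r = small_proj (g a) r"
proof
  show "(\<lambda>V. g ` V) ` small_proj a r \<subseteq> small_proj (g a) r"
    using g by (auto simp: small_proj_def grassmannian_isometry_image orth_proj_isometry_image
        orthogonal_transformation_norm)
  show "small_proj (g a) r \<subseteq> (\<lambda>V. g ` V) ` small_proj a r"
  proof
    fix W assume W: "W \<in> small_proj (g a) r"
    have W': "g ` (inv g ` W) = W"
      using orthogonal_transformation_surj[OF g] by (simp add: image_f_inv_f)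
    have "norm (g (orth_proj (inv g ` W) a)) = norm (orth_proj W (g a))"
      by (metis W' g orth_proj_isometry_image)
    then have "inv g ` W \<in> small_proj a r"
      using W g by (simp add: small_proj_def grassmannian_isometry_image
          orthogonal_transformation_inv orthogonal_transformation_norm)
    then show "W \<in> (\<lambda>V. g ` V) ` small_proj a r" using W' by (metis imageI)
  qed
qed

text \<open>A transformation carrying the line through \<open>a\<close> to the line through
  \<open>b\<close> sends \<open>a\<close> to plus or minus \<open>b\<close>, as the norms agree, and
  the sign does not affect \<open>small_proj\<close>.\<close>

lemma prob_small_proj_norm_cong:
  assumes n: "norm a = norm b"
  shows "prob (small_proj a r) = prob (small_proj b r)"
proof (cases "a = 0")
  case False
  then have "b \<noteq> 0" using n by auto
  then obtain g where g: "orthogonal_transformation g" "g ` span {a} = span {b}"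
    using False orthogonal_transformation_image_subspace_exists[of "span {a}" "span {b}"] by auto
  then have "g a \<in> span {b}" by (metis imageI insertI1 span_base)
  then obtain c where c: "g a = c *\<^sub>R b" by (auto simp: span_singleton)
  have "\<bar>c\<bar> * norm b = norm b" using orthogonal_transformation_norm[OF g(1), of a] c n by simp
  then have "\<bar>c\<bar> = 1" using \<open>b \<noteq> 0\<close> by simp
  then have "small_proj (g a) r = small_proj b r"
    by (simp add: c small_proj_def linear_scale[OF linear_orth_proj])
  then show ?thesis
    using emeasure_isometry_image[OF g(1) small_proj_in_sets, of a r] small_proj_isometry_image[OF g(1)]
    by (simp add: measure_def)
qed (use n in auto)

text \<open>
  By invariance the left-hand side depends only on \<open>r / norm a\<close>, so it may be averaged over the points
  of a grid of mesh about \<open>r / norm a\<close>; for a fixed \<open>V\<close> one counts the grid points in a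
  thin neighbourhood of the orthogonal complement of \<open>V\<close>.
\<close>

lemma prob_small_proj_le:
  "prob (small_proj a r) \<le> (4 * real DIM('a) * real DIM('a) + 2) ^ DIM('a) * (r / norm a) ^ k"
  if "a \<noteq> 0" "r > 0" for a :: 'a
proof -
  define p where "p = DIM('a)"
  have "p > 0" by (simp add: p_def)
  define \<theta> where "\<theta> = r / norm a"
  have "\<theta> > 0" using that by (simp add: \<theta>_def)
  define C :: real where "C = (4 * real p * real p + 2) ^ p"
  have "C \<ge> 1" by (simp add: C_def add_increasing)
  have "grassmannian k \<noteq> ({} :: 'a set set)" using not_empty space_eq by simp
  then obtain V0 :: "'a set" where "V0 \<in> grassmannian k" by blast
  then have "k \<le> p" using dim_subset_UNIV by (auto simp: grassmannian_def p_def)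
  show ?thesis
  \<comment> \<open>For \<theta> > 1 the claimed bound is at least 1, hence trivial.\<close>
  proof (cases "\<theta> \<le> 1")
    case False
    then have "1 \<le> C * \<theta> ^ k" using \<open>C \<ge> 1\<close> by (simp add: mult_ge1_I one_le_power)
    then have "prob (small_proj a r) \<le> C * \<theta> ^ k"
      using prob_le_1[of "small_proj a r"] by linarith
    then show ?thesis by (simp add: C_def \<theta>_def p_def)
  next
    case True
    \<comment> \<open>The mesh 1 / N is at least \<theta>, so the grid points are
      \<theta>-separated, while N + 1 > 1 / \<theta> provides at least (1 / \<theta>) ^ p of
      them.\<close>
    define N where "N = nat \<lfloor>1 / \<theta>\<rfloor>"
    have "1 / \<theta> \<ge> 1" using True \<open>\<theta> > 0\<close> by simp
    then have "N \<ge> 1" "real N \<le> 1 / \<theta>" "1 / \<theta> < real N + 1" unfolding N_def by linarith+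
    then have "\<theta> \<le> 1 / N" using \<open>\<theta> > 0\<close> by (simp add: field_simps)
    \<comment> \<open>Indices start at \<open>N\<close> to place the grid in the cube [1, 2] ^ p,
      away from the origin: all norms lie between 1 and 2 * p.\<close>
    define I where "I = PiE (Basis :: 'a set) (\<lambda>_. {N..2 * N})"
    have "finite I" unfolding I_def by (intro finite_PiE) auto
    have cI: "card I = (N + 1) ^ p" by (simp add: I_def card_PiE p_def)
    define pt where "pt f = (\<Sum>b\<in>Basis. (real (f b) / N) *\<^sub>R b)" for f :: "'a \<Rightarrow> nat"
    have pt_inner: "pt f \<bullet> b = real (f b) / N" if "b \<in> Basis" for f b
      using that by (simp add: pt_def inner_sum_left inner_Basis if_distrib cong: if_cong)
    have pt_range: "1 \<le> pt f \<bullet> b" "pt f \<bullet> b \<le> 2" if "f \<in> I" "b \<in> Basis" for f b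
      using that \<open>N \<ge> 1\<close> PiE_mem[of f Basis "\<lambda>_. {N..2 * N}" b]
      by (auto simp: pt_inner I_def le_divide_eq divide_le_eq)
    have norm_pt: "1 \<le> norm (pt f)" "norm (pt f) \<le> 2 * p" if "f \<in> I" for f
    proof -
      obtain b :: 'a where "b \<in> Basis" using nonempty_Basis by blast
      then show "1 \<le> norm (pt f)"
        using pt_range(1)[OF that, of b] Basis_le_norm[of b "pt f"] by linarith
      have "norm (pt f) \<le> (\<Sum>b\<in>Basis. \<bar>pt f \<bullet> b\<bar>)" by (rule norm_le_l1)
      also have "\<dots> \<le> (\<Sum>b\<in>(Basis::'a set). 2)"
        using pt_range[OF that] by (intro sum_mono) (smt (verit, best))
      finally show "norm (pt f) \<le> 2 * p" by (simp add: p_def)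
    qed
    have pt_sep: "\<theta> \<le> norm (pt f - pt g)" if "f \<in> I" "g \<in> I" "f \<noteq> g" for f g
    proof -
      have "f = g" if "\<And>b. b \<in> Basis \<Longrightarrow> f b = g b"
        using \<open>f \<in> I\<close> \<open>g \<in> I\<close> that unfolding I_def by (rule PiE_ext)
      then obtain b where b: "b \<in> Basis" "f b \<noteq> g b" using \<open>f \<noteq> g\<close> by metis
      then have "1 \<le> \<bar>real (f b) - real (g b)\<bar>" by linarith
      then have "1 / N \<le> \<bar>real (f b) - real (g b)\<bar> / N" by (rule divide_right_mono) simp
      then have "1 / N \<le> \<bar>real (f b) / N - real (g b) / N\<bar>"
        by (simp only: diff_divide_distrib[symmetric] abs_divide abs_of_nat)
      also have "\<dots> \<le> norm (pt f - pt g)"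
        using Basis_le_norm[OF b(1), of "pt f - pt g"] by (simp add: inner_diff_left pt_inner b)
      finally show ?thesis using \<open>\<theta> \<le> 1 / N\<close> by linarith
    qed
    \<comment> \<open>Rescaling \<open>a\<close> to the norm of \<open>pt f\<close> turns the radius
      into \<theta> * norm (pt f), which is at most \<theta> * (2 * p).\<close>
    have le: "prob (small_proj a r) \<le> prob (small_proj (pt f) (\<theta> * (2 * p)))" if "f \<in> I" for f
    proof -
      define s where "s = norm (pt f) / norm a"
      have "s > 0" using norm_pt[OF that] \<open>a \<noteq> 0\<close> by (auto simp: s_def intro!: divide_pos_pos)
      have "prob (small_proj a r) = prob (small_proj (s *\<^sub>R a) (s * r))"
        using small_proj_scaleR[OF \<open>s > 0\<close>] by simp
      also have "\<dots> = prob (small_proj (pt f) (s * r))"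
        using \<open>a \<noteq> 0\<close> by (intro prob_small_proj_norm_cong) (simp add: s_def)
      also have "\<dots> \<le> prob (small_proj (pt f) (\<theta> * (2 * p)))"
      proof (rule finite_measure_mono[OF _ small_proj_in_sets])
        have "s * r \<le> \<theta> * (2 * p)"
          using mult_left_mono[OF norm_pt(2)[OF that], of \<theta>] \<open>\<theta> > 0\<close>
          by (simp add: s_def \<theta>_def mult.commute)
        then show "small_proj (pt f) (s * r) \<subseteq> small_proj (pt f) (\<theta> * (2 * p))"
          by (auto simp: small_proj_def)
      qed
      finally show ?thesis .
    qed
    \<comment> \<open>In a basis adapted to \<open>V\<close>, the \<open>k\<close> short coordinates
      range over a bounded number of cells; only the other p - k contribute a factor of order 1 /
      \<theta> each.\<close>
    have count: "real (card {f \<in> I. V \<in> small_proj (pt f) (\<theta> * (2 * p))}) \<le> C * (1 / \<theta>) ^ (p - k)"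
      if "V \<in> space \<gamma>" for V
    proof -
      have V: "V \<in> grassmannian k" using that space_eq by simp
      obtain O1 O2 :: "'a set" where O: "finite O1" "finite O2" "card O1 = k"
        "card O2 = DIM('a) - k" "O1 \<inter> O2 = {}" "O1 \<subseteq> V" "pairwise orthogonal (O1 \<union> O2)"
        "\<And>u. u \<in> O1 \<union> O2 \<Longrightarrow> norm u = 1" "span (O1 \<union> O2) = UNIV"
        by (rule grassmannian_adapted_basis[OF V]) metis
      define R where "R u = (if u \<in> O1 then \<theta> * (2 * p) else 2 * p)" for u
      let ?S = "{f \<in> I. V \<in> small_proj (pt f) (\<theta> * (2 * p))}"
      have cU: "card (O1 \<union> O2) = p"
        using O \<open>k \<le> p\<close> by (simp add: card_Un_disjoint p_def)
      have "real (card ?S) \<le> (\<Prod>u\<in>O1 \<union> O2. 2 * R u / (\<theta> / p) + 2)"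
      proof (rule card_separated_coordinates_le(2)[where c = "\<lambda>u f. pt f \<bullet> u"])
        show "finite (O1 \<union> O2)" using O by simp
        show "\<theta> / p > 0" using \<open>\<theta> > 0\<close> \<open>p > 0\<close> by simp
        show "R u \<ge> 0" for u using \<open>\<theta> > 0\<close> by (simp add: R_def)
        show "\<bar>pt f \<bullet> u\<bar> \<le> R u" if f: "f \<in> ?S" and u: "u \<in> O1 \<union> O2" for f u
        proof (cases "u \<in> O1")
          case True
          then have "\<bar>pt f \<bullet> u\<bar> = \<bar>orth_proj V (pt f) \<bullet> u\<bar>"
            using O(6) by (simp add: inner_orth_proj subset_iff)
          also have "\<dots> \<le> norm (orth_proj V (pt f))"
            using Cauchy_Schwarz_ineq2[of _ u] O(8)[OF u] by simp
          also have "\<dots> \<le> R u" using f True by (simp add: small_proj_def R_def)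
          finally show ?thesis .
        next
          case False
          then show ?thesis
            using Cauchy_Schwarz_ineq2[of "pt f" u] O(8)[OF u] norm_pt(2)[of f] f by (simp add: R_def)
        qed
        show "\<exists>u\<in>O1 \<union> O2. \<theta> / p \<le> \<bar>pt f \<bullet> u - pt g \<bullet> u\<bar>"
          if fg: "f \<in> ?S" "g \<in> ?S" "f \<noteq> g" for f g
        proof (rule ccontr)
          assume "\<not> ?thesis"
          then have lt: "\<bar>(pt f - pt g) \<bullet> u\<bar> < \<theta> / p" if "u \<in> O1 \<union> O2" for u
            using that by (simp add: inner_diff_left not_le)
          have "norm (pt f - pt g) \<le> (\<Sum>u\<in>O1 \<union> O2. \<bar>(pt f - pt g) \<bullet> u\<bar>)"
            using O by (intro norm_le_sum_abs_inner_orthonormal) auto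
          also have "\<dots> < (\<Sum>u\<in>O1 \<union> O2. \<theta> / p)"
            using lt cU \<open>p > 0\<close> O by (intro sum_strict_mono) auto
          also have "\<dots> = \<theta>" using \<open>p > 0\<close> by (simp only: sum_constant cU) simp
          finally show False using pt_sep[of f g] fg by simp
        qed
      qed
      also have "\<dots> = (\<Prod>u\<in>O1. 2 * R u / (\<theta> / p) + 2) * (\<Prod>u\<in>O2. 2 * R u / (\<theta> / p) + 2)"
        using O by (intro prod.union_disjoint) auto
      also have "(\<Prod>u\<in>O1. 2 * R u / (\<theta> / p) + 2) = (\<Prod>u\<in>O1. 4 * real p * real p + 2)"
        using \<open>\<theta> > 0\<close> \<open>p > 0\<close> by (intro prod.cong) (auto simp: R_def field_simps)
      also have "(\<Prod>u\<in>O2. 2 * R u / (\<theta> / p) + 2) = (\<Prod>u\<in>O2. 4 * real p * real p / \<theta> + 2)"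
        using O(5) \<open>\<theta> > 0\<close> \<open>p > 0\<close> by (intro prod.cong) (auto simp: R_def field_simps)
      also have "(\<Prod>u\<in>O1. 4 * real p * real p + 2) * (\<Prod>u\<in>O2. 4 * real p * real p / \<theta> + 2) =
          (4 * real p * real p + 2) ^ k * (4 * real p * real p / \<theta> + 2) ^ (p - k)"
        by (simp only: prod_constant O(3,4) p_def)
      also have "\<dots> \<le> (4 * real p * real p + 2) ^ k * ((4 * real p * real p + 2) * (1 / \<theta>)) ^ (p - k)"
        using True \<open>\<theta> > 0\<close> by (intro mult_left_mono power_mono) (auto simp: field_simps)
      also have "\<dots> = C * (1 / \<theta>) ^ (p - k)"
        unfolding power_mult_distrib mult.assoc[symmetric] power_add[symmetric]
        using \<open>k \<le> p\<close> by (simp add: C_def)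
      finally show ?thesis .
    qed
    \<comment> \<open>Averaging over at least (1 / \<theta>) ^ p grid points, of which at most C *
      (1 / \<theta>) ^ (p - k) count for any \<open>V\<close>, leaves C * \<theta> ^ k.\<close>
    have "(1 / \<theta>) ^ p * prob (small_proj a r) \<le> real (card I) * prob (small_proj a r)"
      using \<open>1 / \<theta> < real N + 1\<close> \<open>\<theta> > 0\<close>
      by (intro mult_right_mono) (simp_all add: cI power_mono add.commute)
    also have "\<dots> = (\<Sum>f\<in>I. prob (small_proj a r))" by simp
    also have "\<dots> \<le> (\<Sum>f\<in>I. prob (small_proj (pt f) (\<theta> * (2 * p))))"
      using le by (rule sum_mono)
    also have "\<dots> \<le> C * (1 / \<theta>) ^ (p - k)"
      using \<open>finite I\<close> small_proj_in_sets count by (intro sum_prob_le_of_card_le) auto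
    finally have "\<theta> ^ p * ((1 / \<theta>) ^ p * prob (small_proj a r)) \<le> \<theta> ^ p * (C * (1 / \<theta>) ^ (p - k))"
      using \<open>\<theta> > 0\<close> by (intro mult_left_mono) auto
    moreover have "\<theta> ^ p = \<theta> ^ k * \<theta> ^ (p - k)" using \<open>k \<le> p\<close> by (simp flip: power_add)
    ultimately have "prob (small_proj a r) \<le> C * \<theta> ^ k"
      using \<open>\<theta> > 0\<close> by (simp add: power_one_over field_simps)
    then show ?thesis by (simp add: C_def \<theta>_def p_def)
  qed
qed

end


section \<open>Expected number of close pairs\<close>

lemma norm_orth_proj_Times_le:
  assumes V: "V \<in> grassmannian k" and U: "finite U" "U \<subseteq> V" "pairwise orthogonal U"
    "\<And>u. u \<in> U \<Longrightarrow> norm u = 1" "span U = V"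
  shows "norm (orth_proj (V \<times> UNIV) z) \<le>
    (\<Sum>u\<in>U. \<bar>fst z \<bullet> u\<bar>) + (\<Sum>b\<in>Basis. \<bar>snd z \<bullet> b\<bar>)"
proof -
  have sub: "subspace V" using V by (simp add: grassmannian_def)
  have "norm (orth_proj (V \<times> UNIV) z) \<le> norm (orth_proj V (fst z)) + norm (snd z)"
    using norm_Pair_le[of "orth_proj V (fst z)" "snd z"] orth_proj_Times_UNIV[OF sub, of "fst z" "snd z"]
    by simp
  moreover have "norm (orth_proj V (fst z)) \<le> (\<Sum>u\<in>U. \<bar>orth_proj V (fst z) \<bullet> u\<bar>)"
    using U(1,3,4,5) orth_proj_in_span[of V "fst z"] sub
    by (intro norm_le_sum_abs_inner_orthonormal) (simp_all, metis span_eq_iff)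
  moreover have "(\<Sum>u\<in>U. \<bar>orth_proj V (fst z) \<bullet> u\<bar>) = (\<Sum>u\<in>U. \<bar>fst z \<bullet> u\<bar>)"
    using U(2) by (intro sum.cong) (auto simp: inner_orth_proj)
  ultimately show ?thesis using norm_le_l1[of "snd z"] by linarith
qed

text \<open>Along \<open>V\<close> the points spread over distance \<open>r\<close>, but in the
  \<open>UNIV\<close> directions only over \<delta>, so cells of side \<delta> / q are numerous in
  \<open>k\<close> directions only. The exponent \<open>k\<close> thus matches the decay in
  \<open>prob_small_proj_le\<close>.\<close>

lemma card_separated_slab_le:
  fixes Y :: "('a::euclidean_space \<times> 'b::euclidean_space) set"
  assumes V: "V \<in> grassmannian k" and \<delta>: "0 < \<delta>" "\<delta> \<le> r"
    and sep: "\<And>x y. x \<in> Y \<Longrightarrow> y \<in> Y \<Longrightarrow> x \<noteq> y \<Longrightarrow> \<delta> < norm (orth_proj (V \<times> UNIV) (x - y))"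
    and bound: "\<And>y. y \<in> Y \<Longrightarrow> norm (fst (x0 - y)) \<le> r \<and> norm (snd (x0 - y)) \<le> \<delta>"
  shows "real (card Y) \<le> (2 * real (k + DIM('b)) + 2) ^ (k + DIM('b)) * (r / \<delta>) ^ k"
proof -
  define q where "q = k + DIM('b)"
  have "q > 0" by (simp add: q_def)
  obtain U where U: "finite U" "card U = k" "U \<subseteq> V" "pairwise orthogonal U"
    "\<And>u. u \<in> U \<Longrightarrow> norm u = 1" "span U = V"
    by (rule grassmannian_orthonormal_basis[OF V]) metis
  define c :: "'a + 'b \<Rightarrow> 'a \<times> 'b \<Rightarrow> real"
    where "c i y = (case i of Inl u \<Rightarrow> fst (x0 - y) \<bullet> u | Inr b \<Rightarrow> snd (x0 - y) \<bullet> b)" for i y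
  define R :: "'a + 'b \<Rightarrow> real" where "R i = (case i of Inl u \<Rightarrow> r | Inr b \<Rightarrow> \<delta>)" for i
  let ?I = "U <+> (Basis :: 'b set)"
  have "real (card Y) \<le> (\<Prod>i\<in>?I. 2 * R i / (\<delta> / q) + 2)"
  proof (rule card_separated_coordinates_le(2)[where c = c])
    show "finite ?I" using U by simp
    show "\<delta> / q > 0" using \<delta> \<open>q > 0\<close> by simp
    show "R i \<ge> 0" for i using \<delta> by (auto simp: R_def split: sum.split)
    show "\<bar>c i y\<bar> \<le> R i" if y: "y \<in> Y" and i: "i \<in> ?I" for y i
    proof -
      have ip: "\<bar>v \<bullet> u\<bar> \<le> s" if "norm v \<le> s" "norm u = 1" for v u :: "'c::real_inner" and s
        using Cauchy_Schwarz_ineq2[of v u] that by simp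
      show ?thesis
        using i bound[OF y] U(5) by (auto simp: c_def R_def intro!: ip simp del: fst_diff snd_diff)
    qed
    show "\<exists>i\<in>?I. \<delta> / q \<le> \<bar>c i x - c i y\<bar>" if xy: "x \<in> Y" "y \<in> Y" "x \<noteq> y" for x y
    proof (rule ccontr)
      assume neg: "\<not> ?thesis"
      have lt1: "\<bar>fst (x - y) \<bullet> u\<bar> \<le> \<delta> / q" if "u \<in> U" for u
      proof -
        have "\<bar>c (Inl u) x - c (Inl u) y\<bar> < \<delta> / q" using neg that by force
        moreover have "c (Inl u) x - c (Inl u) y = - (fst (x - y) \<bullet> u)"
          by (simp add: c_def inner_diff_left)
        ultimately show ?thesis by simp
      qed
      have lt2: "\<bar>snd (x - y) \<bullet> b\<bar> \<le> \<delta> / q" if "b \<in> Basis" for b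
      proof -
        have "\<bar>c (Inr b) x - c (Inr b) y\<bar> < \<delta> / q" using neg that by force
        moreover have "c (Inr b) x - c (Inr b) y = - (snd (x - y) \<bullet> b)"
          by (simp add: c_def inner_diff_left)
        ultimately show ?thesis by simp
      qed
      have "\<delta> < norm (orth_proj (V \<times> UNIV) (x - y))" using sep xy by blast
      also have "\<dots> \<le> (\<Sum>u\<in>U. \<bar>fst (x - y) \<bullet> u\<bar>) + (\<Sum>b\<in>Basis. \<bar>snd (x - y) \<bullet> b\<bar>)"
        using U by (intro norm_orth_proj_Times_le[OF V]) auto
      also have "\<dots> \<le> real k * (\<delta> / q) + real DIM('b) * (\<delta> / q)"
        using sum_mono[of U "\<lambda>u. \<bar>fst (x - y) \<bullet> u\<bar>" "\<lambda>_. \<delta> / q"] U(2) lt1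
          sum_mono[of Basis "\<lambda>b. \<bar>snd (x - y) \<bullet> b\<bar>" "\<lambda>_. \<delta> / q"] lt2
        by simp
      also have "\<dots> = \<delta>" using \<open>q > 0\<close> by (simp add: q_def distrib_right[symmetric] del: times_divide_eq_right)
        (simp flip: of_nat_add)
      finally show False by simp
    qed
  qed
  also have "\<dots> = (2 * q * (r / \<delta>) + 2) ^ k * (2 * real q + 2) ^ DIM('b)"
    using U \<delta> by (subst prod.Plus) (simp_all add: R_def o_def mult_ac)
  also have "\<dots> \<le> ((2 * real q + 2) * (r / \<delta>)) ^ k * (2 * real q + 2) ^ DIM('b)"
    using \<delta> by (intro mult_right_mono power_mono) (auto simp: field_simps)
  also have "\<dots> = (2 * real q + 2) ^ q * (r / \<delta>) ^ k"
    by (simp only: power_mult_distrib power_add q_def mult_ac)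
  finally show ?thesis by (simp add: q_def)
qed

section \<open>Subspaces along which two points come close\<close>

definition near_set ::
    "nat \<Rightarrow> real \<Rightarrow> 'a::euclidean_space \<times> 'b::euclidean_space \<Rightarrow> 'a set set" where
  "near_set k \<delta> z = {V \<in> grassmannian k. norm (orth_proj (V \<times> UNIV) z) \<le> \<delta>}"

lemma norm_orth_proj_Times_UNIV:
  assumes "V \<in> grassmannian k"
  shows "norm (orth_proj (V \<times> UNIV) z) = sqrt ((norm (orth_proj V (fst z)))\<^sup>2 + (norm (snd z))\<^sup>2)"
  using assms orth_proj_Times_UNIV[of V "fst z" "snd z"] by (simp add: grassmannian_def norm_Pair)

text \<open>The two coordinates separate: the first bound is an event of type
  \<open>small_proj\<close>, while the second does not involve \<open>V\<close> and decides whether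
  the set can be nonempty.\<close>

lemma near_setD:
  assumes "V \<in> near_set k \<delta> z"
  shows "norm (orth_proj V (fst z)) \<le> \<delta>" "norm (snd z) \<le> \<delta>"
proof -
  have "sqrt ((norm (orth_proj V (fst z)))\<^sup>2 + (norm (snd z))\<^sup>2) \<le> \<delta>"
    using assms by (auto simp: near_set_def norm_orth_proj_Times_UNIV)
  then show "norm (orth_proj V (fst z)) \<le> \<delta>" "norm (snd z) \<le> \<delta>"
    using real_sqrt_sum_squares_ge1[of "norm (orth_proj V (fst z))" "norm (snd z)"]
      real_sqrt_sum_squares_ge2[of "norm (snd z)" "norm (orth_proj V (fst z))"] by linarith+
qed

text \<open>For fixed \<open>z\<close> the condition is again an upper bound on
  \<open>norm (orth_proj V (fst z))\<close>, with radius given by Pythagoras, or it is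
  unsatisfiable.\<close>

lemma closedin_near_set: "closedin (grass_topology k) (near_set k \<delta> z)"
proof (cases "norm (snd z) \<le> \<delta>")
  case True
  then have "\<delta> \<ge> 0" using norm_ge_zero[of "snd z"] by linarith
  have "sqrt (t\<^sup>2 + (norm (snd z))\<^sup>2) \<le> \<delta> \<longleftrightarrow> t \<le> sqrt (\<delta>\<^sup>2 - (norm (snd z))\<^sup>2)" if "t \<ge> 0" for t
    using real_sqrt_le_iff[of "t\<^sup>2 + (norm (snd z))\<^sup>2" "\<delta>\<^sup>2"]
      real_sqrt_le_iff[of "t\<^sup>2" "\<delta>\<^sup>2 - (norm (snd z))\<^sup>2"] that \<open>\<delta> \<ge> 0\<close>
    by (simp add: le_diff_eq)
  then have "near_set k \<delta> z =
    {V \<in> grassmannian k. norm (orth_proj V (fst z)) \<le> sqrt (\<delta>\<^sup>2 - (norm (snd z))\<^sup>2)}"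
    by (auto simp: near_set_def norm_orth_proj_Times_UNIV)
  then show ?thesis by (simp add: closedin_orth_proj_le)
next
  case False
  then have "near_set k \<delta> z = {}" using near_setD(2) by blast
  then show ?thesis by simp
qed

context grassmannian_measure
begin

lemma near_set_in_sets: "near_set k \<delta> z \<in> sets \<gamma>"
  by (rule closed_in_sets[OF closedin_near_set])

text \<open>
  Each of the \<open>J + 1\<close> dyadic shells around \<open>x0\<close> contributes a bounded amount: the number of points in
  the shell of radius \<open>2 ^ j * \<delta>\<close> is of order \<open>2 ^ (j * k)\<close>, and each has probability of
  order \<open>2 ^ - (j * k)\<close>.
\<close>

lemma sum_prob_near_set_le:
  fixes X :: "('a \<times> 'b::euclidean_space) set"
  assumes V: "V \<in> grassmannian k" and X: "finite X" and \<delta>: "0 < \<delta>"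
    and sep: "\<And>x y. x \<in> X \<Longrightarrow> y \<in> X \<Longrightarrow> x \<noteq> y \<Longrightarrow> \<delta> < norm (orth_proj (V \<times> UNIV) (x - y))"
  shows "(\<Sum>y\<in>{y \<in> X. norm (fst (x0 - y)) \<le> 2 ^ J * \<delta>}. prob (near_set k \<delta> (x0 - y))) \<le>
    (4 * real DIM('a) * real DIM('a) + 2) ^ DIM('a) * 2 ^ k *
    (2 * real (k + DIM('b)) + 2) ^ (k + DIM('b)) * (1 + real J)"
proof -
  define C :: real where "C = (4 * real DIM('a) * real DIM('a) + 2) ^ DIM('a)"
  define D :: real where "D = (2 * real (k + DIM('b)) + 2) ^ (k + DIM('b))"
  have "C \<ge> 1" "D \<ge> 0" by (simp_all add: C_def D_def add_increasing)
  define S where "S J = {y \<in> X. norm (fst (x0 - y)) \<le> 2 ^ J * \<delta>}" for J :: nat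
  \<comment> \<open>Points of \<open>S J\<close> outside \<open>S' J\<close> contribute nothing:
    their \<open>near_set\<close> is empty.\<close>
  define S' where "S' J = {y \<in> S J. norm (snd (x0 - y)) \<le> \<delta>}" for J
  have fin: "finite (S J)" "finite (S' J)" for J using X by (simp_all add: S_def S'_def)
  have prob0: "prob (near_set k \<delta> (x0 - y)) = 0" if "\<not> norm (snd (x0 - y)) \<le> \<delta>" for y
  proof -
    have "near_set k \<delta> (x0 - y) = {}" using that near_setD(2) by blast
    then show ?thesis by simp
  qed
  have card: "real (card (S' J)) \<le> D * (2 ^ k) ^ J" for J
  proof -
    have "real (card (S' J)) \<le> D * (2 ^ J * \<delta> / \<delta>) ^ k"
      unfolding D_def
    proof (rule card_separated_slab_le[OF V])
      show "\<delta> \<le> 2 ^ J * \<delta>" using \<delta> by simp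
    qed (use \<delta> sep in \<open>auto simp: S'_def S_def\<close>)
    then show ?thesis using \<delta> by (simp flip: power_mult add: mult.commute)
  qed
  have "(\<Sum>y\<in>S' J. prob (near_set k \<delta> (x0 - y))) \<le> D + real J * (C * 2 ^ k * D)"
  proof (induction J)
    case 0
    \<comment> \<open>Close to \<open>x0\<close> the estimate for \<open>small_proj\<close> is no
      better than 1, and it does not apply where the first coordinates coincide, so the points are
      merely counted.\<close>
    have "(\<Sum>y\<in>S' 0. prob (near_set k \<delta> (x0 - y))) \<le> (\<Sum>y\<in>S' 0. 1)"
      by (rule sum_mono) (rule prob_le_1)
    then show ?case using card[of 0] by simp
  next
    case (Suc J)
    have sub: "S' J \<subseteq> S' (Suc J)"
    proof -
      have "2 ^ J * \<delta> \<le> 2 ^ Suc J * \<delta>" using \<delta> by simp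
      then show ?thesis unfolding S'_def S_def by (auto intro: order_trans)
    qed
    have far: "prob (near_set k \<delta> (x0 - y)) \<le> C * (1 / 2 ^ J) ^ k" if y: "y \<in> S' (Suc J) - S' J" for y
    proof -
      have gt: "norm (fst (x0 - y)) > 2 ^ J * \<delta>" using y by (auto simp: S'_def S_def)
      then have "norm (fst (x0 - y)) > 0" using \<delta> by (smt (verit) mult_pos_pos zero_less_power)
      have "prob (near_set k \<delta> (x0 - y)) \<le> prob (small_proj (fst (x0 - y)) \<delta>)"
        by (rule finite_measure_mono[OF _ small_proj_in_sets])
           (auto simp: small_proj_def near_set_def near_setD(1)[unfolded near_set_def] simp del: fst_diff)
      also have "\<dots> \<le> C * (\<delta> / norm (fst (x0 - y))) ^ k"
        unfolding C_def using \<open>norm (fst (x0 - y)) > 0\<close> \<delta> by (intro prob_small_proj_le) auto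
      also have "\<dots> \<le> C * (1 / 2 ^ J) ^ k"
        using gt \<open>norm (fst (x0 - y)) > 0\<close> \<delta> \<open>C \<ge> 1\<close>
        by (intro mult_left_mono power_mono) (auto simp: divide_le_eq le_divide_eq mult.commute)
      finally show ?thesis .
    qed
    have "(\<Sum>y\<in>S' (Suc J) - S' J. prob (near_set k \<delta> (x0 - y))) \<le>
        (\<Sum>y\<in>S' (Suc J) - S' J. C * (1 / 2 ^ J) ^ k)"
      by (rule sum_mono) (rule far)
    also have "\<dots> = real (card (S' (Suc J) - S' J)) * (C * (1 / 2 ^ J) ^ k)" by simp
    also have "\<dots> \<le> (D * (2 ^ k) ^ Suc J) * (C * (1 / 2 ^ J) ^ k)"
    proof (rule mult_right_mono)
      have "card (S' (Suc J) - S' J) \<le> card (S' (Suc J))"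
        by (rule card_mono) (use fin in auto)
      then show "real (card (S' (Suc J) - S' J)) \<le> D * (2 ^ k) ^ Suc J"
        using card[of "Suc J"] by linarith
    qed (use \<open>C \<ge> 1\<close> in simp)
    \<comment> \<open>The powers of 2 ^ J cancel; 2 ^ k remains because the outer radius of the
      shell is twice the inner one.\<close>
    also have "\<dots> = C * 2 ^ k * D"
      by (simp add: power_one_over power_mult[symmetric] mult.commute)
    finally have "(\<Sum>y\<in>S' (Suc J) - S' J. prob (near_set k \<delta> (x0 - y))) \<le> C * 2 ^ k * D" .
    moreover have "(\<Sum>y\<in>S' (Suc J). prob (near_set k \<delta> (x0 - y))) =
        (\<Sum>y\<in>S' (Suc J) - S' J. prob (near_set k \<delta> (x0 - y))) + (\<Sum>y\<in>S' J. prob (near_set k \<delta> (x0 - y)))"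
      by (rule sum.subset_diff[OF sub fin(2)])
    ultimately show ?case using Suc.IH by (simp add: distrib_right)
  qed
  moreover have "(\<Sum>y\<in>S J. prob (near_set k \<delta> (x0 - y))) = (\<Sum>y\<in>S' J. prob (near_set k \<delta> (x0 - y)))"
    by (rule sum.mono_neutral_right) (use fin prob0 in \<open>auto simp: S'_def\<close>)
  \<comment> \<open>This lets the innermost part count as one more shell, whence the factor
    \<open>1 + real J\<close>.\<close>
  moreover have "D \<le> C * 2 ^ k * D"
  proof -
    have "1 * 1 \<le> C * 2 ^ k" using \<open>C \<ge> 1\<close> by (intro mult_mono) auto
    then show ?thesis using mult_right_mono[of 1 "C * 2 ^ k" D] \<open>D \<ge> 0\<close> by simp
  qed
  ultimately have "(\<Sum>y\<in>S J. prob (near_set k \<delta> (x0 - y))) \<le> C * 2 ^ k * D * (1 + real J)"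
    by (simp add: algebra_simps)
  then show ?thesis by (simp only: S_def C_def D_def)
qed

text \<open>
  Cauchy--Schwarz is where the threshold comes from: if \<open>M\<close> balls of radius \<open>\<delta> / 2\<close> cover the
  projection of \<open>X\<close>, then at least \<open>(card X)\<^sup>2 / M\<close> pairs of points share a ball.
\<close>

definition crowded :: "real \<Rightarrow> ('a \<times> 'b::euclidean_space) set \<Rightarrow> real \<Rightarrow> 'a set set" where
  "crowded \<delta> X M = {V \<in> grassmannian k.
     (real (card X))\<^sup>2 / M \<le> real (card {p \<in> X \<times> X. V \<in> near_set k \<delta> (fst p - snd p)})}"

lemma closedin_crowded:
  assumes "finite X"
  shows "closedin (grass_topology k) (crowded \<delta> X M)"
proof -
  have "{V \<in> topspace (grass_topology k). V \<in> near_set k \<delta> z} = near_set k \<delta> z"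
    for z :: "'a \<times> 'b"
    by (auto simp: topspace_grass_topology near_set_def)
  then have "closedin (grass_topology k) {V \<in> topspace (grass_topology k).
      (real (card X))\<^sup>2 / M \<le> real (card {p \<in> X \<times> X. V \<in> near_set k \<delta> (fst p - snd p)})}"
    using assms by (intro closedin_card_ge) (auto simp: closedin_near_set)
  then show ?thesis
    by (simp add: crowded_def topspace_grass_topology)
qed

text \<open>Markov's inequality for the number of close pairs. Separation is along the fixed
  \<open>V\<close>, whereas the probability refers to a random subspace. By \<open>diam\<close> the
  shells around any point of \<open>X\<close> reach all of \<open>X\<close>, so every row of the
  pair sum is bounded by the preceding estimate.\<close>

lemma prob_crowded_le:
  fixes X :: "('a \<times> 'b::euclidean_space) set"
  assumes V: "V \<in> grassmannian k" and X: "finite X" "X \<noteq> {}" and \<delta>: "0 < \<delta>" and M: "0 < M"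
    and sep: "\<And>x y. x \<in> X \<Longrightarrow> y \<in> X \<Longrightarrow> x \<noteq> y \<Longrightarrow> \<delta> < norm (orth_proj (V \<times> UNIV) (x - y))"
    and diam: "\<And>x y. x \<in> X \<Longrightarrow> y \<in> X \<Longrightarrow> norm (fst (x - y)) \<le> 2 ^ J * \<delta>"
  shows "prob (crowded \<delta> X M) \<le> (4 * real DIM('a) * real DIM('a) + 2) ^ DIM('a) * 2 ^ k *
    (2 * real (k + DIM('b)) + 2) ^ (k + DIM('b)) * (1 + real J) * (M / card X)"
proof -
  define E where "E = (4 * real DIM('a) * real DIM('a) + 2) ^ DIM('a) * 2 ^ k *
    (2 * real (k + DIM('b)) + 2) ^ (k + DIM('b)) * (1 + real J)"
  have "card X > 0" using X by (simp add: card_gt_0_iff)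
  have row: "(\<Sum>y\<in>X. prob (near_set k \<delta> (x - y))) \<le> E" if "x \<in> X" for x
  proof -
    have "{y \<in> X. norm (fst (x - y)) \<le> 2 ^ J * \<delta>} = X" using diam[OF that] by blast
    then show ?thesis
      using sum_prob_near_set_le[OF V X(1) \<delta> sep, of x J] by (simp add: E_def)
  qed
  have "prob (crowded \<delta> X M) \<le> (\<Sum>p\<in>X \<times> X. prob (near_set k \<delta> (fst p - snd p))) / ((real (card X))\<^sup>2 / M)"
    unfolding crowded_def space_eq[symmetric]
    using X M \<open>card X > 0\<close> by (intro prob_card_ge_le near_set_in_sets) auto
  also have "(\<Sum>p\<in>X \<times> X. prob (near_set k \<delta> (fst p - snd p))) =
      (\<Sum>x\<in>X. \<Sum>y\<in>X. prob (near_set k \<delta> (x - y)))"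
    by (simp add: sum.cartesian_product case_prod_unfold)
  also have "(\<Sum>x\<in>X. \<Sum>y\<in>X. prob (near_set k \<delta> (x - y))) / ((real (card X))\<^sup>2 / M) \<le>
      (real (card X) * E) / ((real (card X))\<^sup>2 / M)"
    using sum_mono[of X "\<lambda>x. \<Sum>y\<in>X. prob (near_set k \<delta> (x - y))" "\<lambda>_. E"] row M
    by (intro divide_right_mono) auto
  also have "\<dots> = E * (M / card X)" using M \<open>card X > 0\<close> by (simp add: power2_eq_square)
  finally show ?thesis by (simp only: E_def)
qed

lemma crowdedI:
  assumes V: "V \<in> grassmannian k" and X: "finite X" and K: "finite K" "real (card K) \<le> M"
    and cover: "orth_proj (V \<times> UNIV) ` X \<subseteq> (\<Union>c\<in>K. cball c (\<delta> / 2))"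
  shows "V \<in> crowded \<delta> X M"
proof (cases "X = {}")
  case False
  let ?\<pi> = "orth_proj (V \<times> (UNIV :: 'b::euclidean_space set))"
  have "\<forall>x\<in>X. \<exists>c\<in>K. dist c (?\<pi> x) \<le> \<delta> / 2"
  proof
    fix x assume "x \<in> X"
    then have "?\<pi> x \<in> (\<Union>c\<in>K. cball c (\<delta> / 2))" using cover by blast
    then show "\<exists>c\<in>K. dist c (?\<pi> x) \<le> \<delta> / 2" by auto
  qed
  \<comment> \<open>Choosing one ball per point splits \<open>X\<close> into disjoint fibres, so no
    pair is counted twice even if balls overlap.\<close>
  then obtain h where h: "\<And>x. x \<in> X \<Longrightarrow> h x \<in> K" "\<And>x. x \<in> X \<Longrightarrow> dist (h x) (?\<pi> x) \<le> \<delta> / 2"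
    by metis
  define n where "n c = card {x \<in> X. h x = c}" for c
  have "card K > 0" using h(1) False K by (auto simp: card_gt_0_iff)
  then have "M > 0" using K(2) by linarith
  have "X = (\<Union>c\<in>K. {x \<in> X. h x = c})" using h(1) by auto
  then have "card X = (\<Sum>c\<in>K. n c)"
    using X K unfolding n_def by (subst card_UN_disjoint[symmetric]) auto
  then have "(real (card X))\<^sup>2 = (\<Sum>c\<in>K. real (n c))\<^sup>2" by simp
  also have "\<dots> \<le> (\<Sum>c\<in>K. (real (n c))\<^sup>2) * real (card K)"
    by (rule sum_squared_le_sum_of_squares)
  also have "\<dots> \<le> (\<Sum>c\<in>K. (real (n c))\<^sup>2) * M"
    using K(2) by (intro mult_left_mono sum_nonneg) auto
  finally have "(real (card X))\<^sup>2 / M \<le> (\<Sum>c\<in>K. (real (n c))\<^sup>2)"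
    using \<open>M > 0\<close> by (simp add: divide_le_eq)
  also have "\<dots> = real (\<Sum>c\<in>K. card ({x \<in> X. h x = c} \<times> {x \<in> X. h x = c}))"
    by (simp add: n_def card_cartesian_product power2_eq_square)
  also have "\<dots> = real (card (\<Union>c\<in>K. {x \<in> X. h x = c} \<times> {x \<in> X. h x = c}))"
    using X K by (subst card_UN_disjoint) auto
  also have "\<dots> \<le> real (card {p \<in> X \<times> X. V \<in> near_set k \<delta> (fst p - snd p)})"
  proof (intro of_nat_mono card_mono)
    show "finite {p \<in> X \<times> X. V \<in> near_set k \<delta> (fst p - snd p)}" using X by simp
    show "(\<Union>c\<in>K. {x \<in> X. h x = c} \<times> {x \<in> X. h x = c}) \<subseteq>
        {p \<in> X \<times> X. V \<in> near_set k \<delta> (fst p - snd p)}"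
    proof
      fix p assume "p \<in> (\<Union>c\<in>K. {x \<in> X. h x = c} \<times> {x \<in> X. h x = c})"
      then have p: "fst p \<in> X" "snd p \<in> X" "h (snd p) = h (fst p)" by auto
      have "dist (?\<pi> (fst p)) (?\<pi> (snd p)) \<le> \<delta> / 2 + \<delta> / 2"
        using h(2)[OF p(1)] h(2)[OF p(2)] dist_triangle3[of "?\<pi> (fst p)" "?\<pi> (snd p)" "h (fst p)"] p(3)
        by simp
      then show "p \<in> {p \<in> X \<times> X. V \<in> near_set k \<delta> (fst p - snd p)}"
        using V p by (simp add: near_set_def dist_norm orth_proj_diff mem_Times_iff)
    qed
  qed
  finally show ?thesis using V by (simp add: crowded_def)
qed (use V in \<open>simp add: crowded_def\<close>)

end


section \<open>Small sets in the Grassmannian\<close>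

context grassmannian_measure
begin

definition closed_null :: "'a set set \<Rightarrow> bool" where
  "closed_null A \<longleftrightarrow> closedin (grass_topology k) A \<and> A \<in> null_sets \<gamma>"

text \<open>Both required kinds of smallness follow from this one. Inclusion in place of equality
  avoids asking whether \<open>S\<close> is measurable.\<close>

definition sigma_closed_null :: "'a set set \<Rightarrow> bool" where
  "sigma_closed_null S \<longleftrightarrow> (\<exists>\<A>. countable \<A> \<and> (\<forall>A\<in>\<A>. closed_null A) \<and> S \<subseteq> \<Union>\<A>)"

lemma sigma_closed_null_subset: "sigma_closed_null S \<Longrightarrow> T \<subseteq> S \<Longrightarrow> sigma_closed_null T"
  unfolding sigma_closed_null_def by (meson order_trans)

lemma sigma_closed_null_UN:
  assumes "countable I" "\<And>i. i \<in> I \<Longrightarrow> sigma_closed_null (S i)"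
  shows "sigma_closed_null (\<Union>i\<in>I. S i)"
proof -
  from assms(2) obtain \<A> where \<A>: "\<And>i. i \<in> I \<Longrightarrow> countable (\<A> i) \<and> (\<forall>A\<in>\<A> i. closed_null A) \<and> S i \<subseteq> \<Union>(\<A> i)"
    unfolding sigma_closed_null_def by metis
  show ?thesis
    unfolding sigma_closed_null_def
  proof (intro exI[of _ "\<Union>i\<in>I. \<A> i"] conjI)
    show "countable (\<Union>i\<in>I. \<A> i)" using assms(1) \<A> by (intro countable_UN) auto
    show "\<forall>A\<in>\<Union>i\<in>I. \<A> i. closed_null A" using \<A> by blast
    show "(\<Union>i\<in>I. S i) \<subseteq> \<Union>(\<Union>i\<in>I. \<A> i)"
    proof (rule UN_least)
      fix i assume i: "i \<in> I"
      have "\<Union>(\<A> i) \<subseteq> \<Union>(\<Union>i\<in>I. \<A> i)" using i by (intro Union_mono UN_upper)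
      then show "S i \<subseteq> \<Union>(\<Union>i\<in>I. \<A> i)" using \<A>[OF i] by (meson order_trans)
    qed
  qed
qed

lemma sigma_closed_null_empty: "sigma_closed_null {}"
  unfolding sigma_closed_null_def by (intro exI[of _ "{}"]) simp

lemma sigma_closed_null_null_sets:
  assumes "sigma_closed_null S"
  shows "S \<in> null_sets (completion \<gamma>)"
proof -
  from assms obtain \<A> where \<A>: "countable \<A>" "\<And>A. A \<in> \<A> \<Longrightarrow> closed_null A" "S \<subseteq> \<Union>\<A>"
    unfolding sigma_closed_null_def by auto
  have "(\<Union>A\<in>\<A>. A) \<in> null_sets \<gamma>"
    using \<A>(1,2) by (intro null_sets_UN') (auto simp: closed_null_def)
  then show ?thesis using \<A>(3) by (intro null_sets_completion_subset[OF \<A>(3)]) (auto intro: null_sets_completionI)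
qed

text \<open>
  By compactness, finitely many balls of a given radius cover the Grassmannian, and they all have
  the same measure since the orthogonal group acts transitively and isometrically.
\<close>

lemma emeasure_open_pos:
  assumes U: "openin (grass_topology k) U" "U \<noteq> {}"
  shows "emeasure \<gamma> U > 0"
proof (rule ccontr)
  interpret G: Metric_space "grassmannian k" "grass_dist :: 'a set \<Rightarrow> 'a set \<Rightarrow> real"
    by (rule Metric_space_grassmannian)
  assume "\<not> emeasure \<gamma> U > 0"
  then have U0: "emeasure \<gamma> U = 0" by simp
  obtain V where "V \<in> U" using U by blast
  then obtain e where e: "e > 0" "G.mball V e \<subseteq> U" and V: "V \<in> grassmannian k"
    using U(1) unfolding grass_topology_def G.openin_mtopology by blast
  have ball_sets: "G.mball W e \<in> sets \<gamma>" for W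
    using open_in_sets[unfolded grass_topology_def, OF G.openin_mball] .
  have "emeasure \<gamma> (G.mball V e) = 0"
    using emeasure_mono[OF e(2) open_in_sets[OF U(1)]] U0 by simp
  have null: "G.mball W e \<in> null_sets \<gamma>" if W: "W \<in> grassmannian k" for W
  proof -
    obtain g where g: "orthogonal_transformation g" "g ` V = W"
      using V W orthogonal_transformation_image_subspace_exists[of V W]
      by (auto simp: grassmannian_def)
    have "G.mball W e \<subseteq> (\<lambda>X. g ` X) ` G.mball V e"
    proof
      fix X assume X: "X \<in> G.mball W e"
      have gi: "g ` (inv g ` X) = X"
        using orthogonal_transformation_surj[OF g(1)] by (simp add: image_f_inv_f)
      have "inv g ` X \<in> grassmannian k"
        using X g(1) by (simp add: grassmannian_isometry_image orthogonal_transformation_inv)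
      moreover have "grass_dist V (inv g ` X) = grass_dist W X"
        using grass_dist_isometry_image[OF g(1), of V "inv g ` X"] gi g(2) by simp
      ultimately have "inv g ` X \<in> G.mball V e" using X V by (simp add: G.in_mball)
      then show "X \<in> (\<lambda>X. g ` X) ` G.mball V e" using gi by (metis imageI)
    qed
    moreover have "(\<lambda>X. g ` X) ` G.mball V e \<subseteq> G.mball W e"
      using g V W grass_dist_isometry_image[OF g(1), of V]
      by (auto simp: G.in_mball grassmannian_isometry_image)
    ultimately have "G.mball W e = (\<lambda>X. g ` X) ` G.mball V e" by (rule subset_antisym)
    then have "emeasure \<gamma> (G.mball W e) = 0"
      using emeasure_isometry_image[OF g(1) ball_sets, of V] \<open>emeasure \<gamma> (G.mball V e) = 0\<close> by simp
    then show ?thesis using ball_sets by blast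
  qed
  obtain F :: "'a set set" where F: "finite F" "F \<subseteq> grassmannian k"
    "\<forall>X\<in>grassmannian k. \<exists>W\<in>F. grass_dist W X < e"
    using grassmannian_finite_cover[OF e(1), of k] by (elim exE conjE)
  have "space \<gamma> \<subseteq> (\<Union>W\<in>F. G.mball W e)"
  proof
    fix X assume "X \<in> space \<gamma>"
    then obtain W where "W \<in> F" "grass_dist W X < e" "X \<in> grassmannian k"
      using F(3) by (auto simp: space_eq)
    then show "X \<in> (\<Union>W\<in>F. G.mball W e)" using F(2) by (auto simp: G.in_mball)
  qed
  moreover have "(\<Union>W\<in>F. G.mball W e) \<in> null_sets \<gamma>"
    using F(1,2) null by (intro null_sets_UN' countable_finite) blast+
  ultimately have "emeasure \<gamma> (space \<gamma>) = 0"
    using null_sets_subset[of "\<Union>W\<in>F. G.mball W e" \<gamma> "space \<gamma>"] by auto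
  then show False by (simp add: emeasure_space_1)
qed

lemma sigma_closed_null_meagre:
  assumes "sigma_closed_null S"
  shows "meagre_in (grass_topology k) S"
proof -
  let ?X = "grass_topology k :: 'a set topology"
  from assms obtain \<A> where \<A>: "countable \<A>" "\<And>A. A \<in> \<A> \<Longrightarrow> closed_null A" "S \<subseteq> \<Union>\<A>"
    unfolding sigma_closed_null_def by auto
  \<comment> \<open>\<open>meagre_in\<close> asks for a union equal to \<open>S\<close>, so the
    closed sets are cut down to \<open>S\<close>.\<close>
  have nd: "nowhere_dense_in ?X (A \<inter> S)" if "A \<in> \<A>" for A
  proof -
    have A: "closedin ?X A" "A \<in> null_sets \<gamma>" using \<A>(2)[OF that] by (auto simp: closed_null_def)
    have "?X closure_of (A \<inter> S) \<subseteq> A" by (intro closure_of_minimal A) auto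
    then have "?X interior_of (?X closure_of (A \<inter> S)) \<subseteq> ?X interior_of A" by (rule interior_of_mono)
    moreover have "?X interior_of A = {}"
    proof (rule ccontr)
      assume "?X interior_of A \<noteq> {}"
      then have "emeasure \<gamma> (?X interior_of A) > 0" by (intro emeasure_open_pos) auto
      moreover have "emeasure \<gamma> (?X interior_of A) \<le> emeasure \<gamma> A"
        using A by (intro emeasure_mono interior_of_subset) auto
      ultimately show False using A by auto
    qed
    moreover have "A \<inter> S \<subseteq> topspace ?X" using closedin_subset[OF A(1)] by auto
    ultimately show ?thesis by (simp add: nowhere_dense_in_def)
  qed
  show ?thesis
    unfolding meagre_in_def
    by (intro exI[of _ "(\<lambda>A. A \<inter> S) ` \<A>"]) (use \<A> nd in auto)
qed

text \<open>The measures tend to 0 along the tail. Every \<open>V\<close> that lies in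
  \<open>A i\<close> for all large \<open>i\<close> belongs to one of these intersections, so such
  \<open>V\<close> form a \<open>sigma_closed_null\<close> set.\<close>

lemma closed_null_INT:
  assumes closed: "\<And>i. closedin (grass_topology k) (A i)"
    and small: "\<And>i :: nat. prob (A i) \<le> 1 / (real i + 1)"
  shows "closed_null (\<Inter>i\<in>{j..}. A i)"
proof -
  let ?F = "\<Inter>i\<in>{j..}. A i"
  have F: "closedin (grass_topology k) ?F"
    using closed by (intro closedin_INT) auto
  have "prob ?F \<le> 1 / (real i + 1)" if "i \<ge> j" for i
    using finite_measure_mono[of ?F "A i"] closed_in_sets[OF closed] small[of i] that by fastforce
  then have "eventually (\<lambda>i. prob ?F \<le> 1 / (real i + 1)) sequentially"
    unfolding eventually_sequentially by blast
  moreover have "(\<lambda>i. 1 / (real i + 1)) \<longlonglongrightarrow> 0"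
    using LIMSEQ_inverse_real_of_nat by (simp add: inverse_eq_divide add.commute)
  ultimately have "prob ?F \<le> 0"
    by (intro tendsto_lowerbound[where F = sequentially]) auto
  then have "prob ?F = 0" by (simp add: measure_le_0_iff)
  then show ?thesis
    using F closed_in_sets[OF F] by (auto simp: closed_null_def emeasure_eq_measure)
qed

end


section \<open>Covering numbers and upper box dimension\<close>

lemma cover_number_finite_cover:
  fixes E :: "'c::euclidean_space set"
  assumes "bounded E" "0 < \<delta>"
  obtains C where "finite C" "card C = cover_number E \<delta>" "E \<subseteq> (\<Union>c\<in>C. cball c \<delta>)"
proof -
  have "compact (closure E)" using assms by (simp add: compact_closure)
  then obtain C where C: "finite C" "closure E \<subseteq> (\<Union>x\<in>C. ball x \<delta>)"
    using seq_compact_imp_totally_bounded[of "closure E"] assms compact_imp_seq_compact by metis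
  have "E \<subseteq> closure E" by (rule closure_subset)
  also have "\<dots> \<subseteq> (\<Union>c\<in>C. cball c \<delta>)"
    using C(2) by (rule order_trans) (intro UN_mono ball_subset_cball subset_refl)
  finally have "\<exists>N. \<exists>C. finite C \<and> card C = N \<and> E \<subseteq> (\<Union>c\<in>C. cball c \<delta>)"
    using C(1) by (intro exI[of _ "card C"] exI[of _ C]) simp
  then have "\<exists>C. finite C \<and> card C = cover_number E \<delta> \<and> E \<subseteq> (\<Union>c\<in>C. cball c \<delta>)"
    unfolding cover_number_def by (rule LeastI_ex)
  then show thesis by (elim exE conjE) (rule that)
qed

lemma cover_number_le_card:
  "finite C \<Longrightarrow> E \<subseteq> (\<Union>c\<in>C. cball c \<delta>) \<Longrightarrow> cover_number E \<delta> \<le> card C"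
  unfolding cover_number_def by (intro Least_le exI[of _ C]) simp

lemma cover_number_mono:
  fixes E F :: "'c::euclidean_space set"
  assumes "E \<subseteq> F" "bounded F" "0 < \<delta>"
  shows "cover_number E \<delta> \<le> cover_number F \<delta>"
proof -
  obtain C where "finite C" "card C = cover_number F \<delta>" "F \<subseteq> (\<Union>c\<in>C. cball c \<delta>)"
    using cover_number_finite_cover[OF assms(2,3)] .
  then show ?thesis using cover_number_le_card[of C E \<delta>] assms(1) by auto
qed

lemma cover_number_pos:
  fixes E :: "'c::euclidean_space set"
  assumes "E \<noteq> {}" "bounded E" "0 < \<delta>"
  shows "cover_number E \<delta> \<ge> 1"
proof -
  obtain C where C: "finite C" "card C = cover_number E \<delta>" "E \<subseteq> (\<Union>c\<in>C. cball c \<delta>)"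
    using cover_number_finite_cover[OF assms(2,3)] .
  have "C \<noteq> {}"
  proof
    assume "C = {}"
    then show False using C(3) assms(1) by simp
  qed
  then have "card C > 0" using C(1) by (simp add: card_gt_0_iff)
  then show ?thesis using C(2) by simp
qed

text \<open>A separated set of largest cardinality is a \<delta>-net after applying
  \<open>f\<close>; a largest one exists because a ball of radius \<delta> / 2 holds the image of at
  most one of its points. \<open>X\<close> is taken in \<open>B\<close> and not in the image so that
  it can be projected along other subspaces.\<close>

lemma separated_set_exists:
  fixes f :: "'d \<Rightarrow> 'c::euclidean_space"
  assumes "bounded (f ` B)" "0 < \<delta>"
  obtains X where "finite X" "X \<subseteq> B" "cover_number (f ` B) \<delta> \<le> card X"
    "\<And>x y. x \<in> X \<Longrightarrow> y \<in> X \<Longrightarrow> x \<noteq> y \<Longrightarrow> \<delta> < dist (f x) (f y)"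
proof -
  define sep where "sep X \<longleftrightarrow> finite X \<and> X \<subseteq> B \<and>
    (\<forall>x\<in>X. \<forall>y\<in>X. x \<noteq> y \<longrightarrow> \<delta> < dist (f x) (f y))" for X
  obtain C where C: "finite C" "card C = cover_number (f ` B) (\<delta> / 2)"
    "f ` B \<subseteq> (\<Union>c\<in>C. cball c (\<delta> / 2))"
    using cover_number_finite_cover[OF assms(1) half_gt_zero[OF assms(2)]] .
  have le: "card X \<le> card C" if X: "sep X" for X
  proof -
    have "\<forall>x\<in>X. \<exists>c\<in>C. dist c (f x) \<le> \<delta> / 2"
    proof
      fix x assume "x \<in> X"
      then have "f x \<in> f ` B" using X by (auto simp: sep_def)
      then have "f x \<in> (\<Union>c\<in>C. cball c (\<delta> / 2))" using C(3) by blast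
      then show "\<exists>c\<in>C. dist c (f x) \<le> \<delta> / 2" by auto
    qed
    then obtain h where h: "\<And>x. x \<in> X \<Longrightarrow> h x \<in> C" "\<And>x. x \<in> X \<Longrightarrow> dist (h x) (f x) \<le> \<delta> / 2"
      by metis
    have "inj_on h X"
    proof (rule inj_onI, rule ccontr)
      fix x y assume xy: "x \<in> X" "y \<in> X" "h x = h y" "x \<noteq> y"
      then have "\<delta> < dist (f x) (f y)" using X by (simp add: sep_def)
      also have "\<dots> \<le> dist (h x) (f x) + dist (h x) (f y)" by (rule dist_triangle3)
      also have "\<dots> \<le> \<delta>" using h(2)[OF xy(1)] h(2)[OF xy(2)] xy(3) by simp
      finally show False by simp
    qed
    then show ?thesis using C(1) h(1) by (intro card_inj_on_le[of h]) auto
  qed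
  have "sep {}" by (simp add: sep_def)
  then have "\<exists>X. sep X \<and> (\<forall>Y. sep Y \<longrightarrow> card Y \<le> card X)"
    by (rule ex_has_greatest_nat[where b = "Suc (card C)"]) (simp add: le less_Suc_eq_le)
  then obtain X where X: "sep X" "\<forall>Y. sep Y \<longrightarrow> card Y \<le> card X" by (elim exE conjE)
  have "f ` B \<subseteq> (\<Union>c\<in>f ` X. cball c \<delta>)"
  proof
    fix z assume "z \<in> f ` B"
    then obtain x where x: "x \<in> B" "z = f x" by blast
    show "z \<in> (\<Union>c\<in>f ` X. cball c \<delta>)"
    proof (rule ccontr)
      assume "z \<notin> (\<Union>c\<in>f ` X. cball c \<delta>)"
      then have far: "\<delta> < dist (f y) (f x)" if "y \<in> X" for y using that x by auto
      then have "x \<notin> X" using assms(2) by fastforce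
      have "sep (insert x X)"
        using X(1) x far by (auto simp: sep_def dist_commute)
      then have "card (insert x X) \<le> card X" using X(2) by simp
      then show False using \<open>x \<notin> X\<close> X(1) by (simp add: sep_def)
    qed
  qed
  then have "cover_number (f ` B) \<delta> \<le> card (f ` X)"
    using X(1) by (intro cover_number_le_card) (auto simp: sep_def)
  also have "\<dots> \<le> card X" using X(1) by (intro card_image_le) (simp add: sep_def)
  finally show thesis using X(1) by (intro that[of X]) (auto simp: sep_def)
qed

section \<open>Covering numbers against powers of the radius\<close>

lemma eventually_at_right_0_less_1: "eventually (\<lambda>\<delta>::real. 0 < \<delta> \<and> \<delta> < 1) (at_right 0)"
  unfolding eventually_at_right_field by (intro exI[of _ 1]) auto

lemma upper_box_dim_less_eventually:
  assumes "upper_box_dim E < ereal s"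
  shows "eventually (\<lambda>\<delta>. real (cover_number E \<delta>) \<le> \<delta> powr (- s)) (at_right 0)"
  using Limsup_lessD[OF assms[unfolded upper_box_dim_def]] eventually_at_right_0_less_1
proof eventually_elim
  case (elim \<delta>)
  show ?case
  \<comment> \<open>Here \<open>ln 0 = 0\<close> carries no information, but the bound is
    trivial.\<close>
  proof (cases "cover_number E \<delta> = 0")
    case False
    have "ln (real (cover_number E \<delta>)) < s * - ln \<delta>"
      using elim pos_divide_less_eq[of "- ln \<delta>" "ln (real (cover_number E \<delta>))" s] by simp
    then have "ln (real (cover_number E \<delta>)) < ln (\<delta> powr (- s))"
      using elim by (simp add: ln_powr)
    then show ?thesis using False elim by (subst (asm) ln_less_cancel_iff) auto
  qed simp
qed

lemma less_upper_box_dim_frequently: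
  fixes E :: "'c::euclidean_space set"
  assumes E: "bounded E" "E \<noteq> {}" and t: "ereal t < upper_box_dim E"
  shows "frequently (\<lambda>\<delta>. \<delta> powr (- t) < real (cover_number E \<delta>)) (at_right 0)"
proof (rule ccontr)
  assume "\<not> ?thesis"
  then have "eventually (\<lambda>\<delta>. \<not> \<delta> powr (- t) < real (cover_number E \<delta>)) (at_right 0)"
    by (simp add: frequently_def)
  then have "eventually (\<lambda>\<delta>. ereal (ln (real (cover_number E \<delta>)) / - ln \<delta>) \<le> ereal t) (at_right 0)"
    using eventually_at_right_0_less_1
  proof eventually_elim
    case (elim \<delta>)
    \<comment> \<open>With covering number 0 the default \<open>ln 0 = 0\<close> would break the
      comparison for negative \<open>t\<close>.\<close>
    have "cover_number E \<delta> \<ge> 1" using E elim by (intro cover_number_pos) auto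
    then have "ln (real (cover_number E \<delta>)) \<le> ln (\<delta> powr (- t))"
      using elim by (subst ln_le_cancel_iff) auto
    then have "ln (real (cover_number E \<delta>)) \<le> t * - ln \<delta>" using elim by (simp add: ln_powr)
    then show ?case
      using elim pos_divide_le_eq[of "- ln \<delta>" "ln (real (cover_number E \<delta>))" t] by simp
  qed
  then have "upper_box_dim E \<le> ereal t"
    unfolding upper_box_dim_def by (rule Limsup_bounded)
  then show False using t by simp
qed


section \<open>Upper box dimension of projections\<close>

lemma bounded_proj_image:
  assumes "bounded B"
  shows "bounded (proj_image B V)"
  unfolding proj_image_def
  using assms linear_orth_proj by (intro bounded_linear_image linear_conv_bounded_linear[THEN iffD1])

context grassmannian_measure
begin

text \<open>The estimate at a single scale. The set \<open>crowded \<delta> X M\<close> is built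
  from \<open>V0\<close> alone, yet it catches all \<open>V\<close> with cheap covers at once.
  Covers have radius \<delta> / 2 because points sharing such a ball are \<delta>-close.\<close>

lemma crowded_cover_exists:
  fixes B :: "('a \<times> 'b::euclidean_space) set"
  defines "E \<equiv> (4 * real DIM('a) * real DIM('a) + 2) ^ DIM('a) * 2 ^ k *
    (2 * real (k + DIM('b)) + 2) ^ (k + DIM('b))"
  assumes B: "bounded B" and V0: "V0 \<in> grassmannian k"
    and r: "\<And>x y. x \<in> B \<Longrightarrow> y \<in> B \<Longrightarrow> norm (fst (x - y)) \<le> r"
    and \<delta>: "0 < \<delta>" "\<delta> \<le> r" and M: "0 < M"
    and N: "\<delta> powr (- t) < real (cover_number (proj_image B V0) \<delta>)"
  obtains A where "closedin (grass_topology k) A"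
    "prob A \<le> E * (2 + log 2 (r / \<delta>)) * (M * \<delta> powr t)"
    "\<And>V. V \<in> grassmannian k \<Longrightarrow> real (cover_number (proj_image B V) (\<delta> / 2)) \<le> M \<Longrightarrow> V \<in> A"
proof -
  obtain X where X: "finite X" "X \<subseteq> B" "cover_number (proj_image B V0) \<delta> \<le> card X"
    "\<And>x y. x \<in> X \<Longrightarrow> y \<in> X \<Longrightarrow> x \<noteq> y \<Longrightarrow>
      \<delta> < dist (orth_proj (V0 \<times> UNIV) x) (orth_proj (V0 \<times> UNIV) y)"
    using separated_set_exists[of "orth_proj (V0 \<times> UNIV)" B \<delta>] bounded_proj_image[OF B, of V0] \<delta>(1)
    unfolding proj_image_def by metis
  have cX: "\<delta> powr (- t) \<le> real (card X)" using N X(3) by linarith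
  have "0 < \<delta> powr (- t)" using \<delta> by simp
  then have "card X > 0" using cX by linarith
  then have "X \<noteq> {}" by auto
  \<comment> \<open>The fewest doublings of \<delta> that reach \<open>r\<close>; rounding up costs
    1, whence the 2 in the bound.\<close>
  define J where "J = nat \<lceil>log 2 (r / \<delta>)\<rceil>"
  have "r / \<delta> \<ge> 1" using \<delta> by simp
  then have "log 2 (r / \<delta>) \<ge> 0" by simp
  then have J: "log 2 (r / \<delta>) \<le> real J" "real J \<le> log 2 (r / \<delta>) + 1"
    unfolding J_def by linarith+
  have "r / \<delta> = 2 powr (log 2 (r / \<delta>))" using \<open>r / \<delta> \<ge> 1\<close> by simp
  also have "\<dots> \<le> 2 powr (real J)" using J(1) by (intro powr_mono) auto
  also have "\<dots> = 2 ^ J" by (simp add: powr_realpow)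
  finally have rJ: "r \<le> 2 ^ J * \<delta>" using \<delta> by (simp add: divide_le_eq)
  show thesis
  proof (rule that[of "crowded \<delta> X M"])
    show "closedin (grass_topology k) (crowded \<delta> X M)" by (rule closedin_crowded[OF X(1)])
    have "E \<ge> 0" unfolding E_def by simp
    have "prob (crowded \<delta> X M) \<le> E * (1 + real J) * (M / card X)"
      unfolding E_def
    proof (rule prob_crowded_le[OF V0 X(1) \<open>X \<noteq> {}\<close> \<delta>(1) M])
      show "\<delta> < norm (orth_proj (V0 \<times> UNIV) (x - y))" if "x \<in> X" "y \<in> X" "x \<noteq> y" for x y
        using X(4)[OF that] by (simp add: dist_norm orth_proj_diff)
      show "norm (fst (x - y)) \<le> 2 ^ J * \<delta>" if "x \<in> X" "y \<in> X" for x y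
        using r[of x y] that X(2) rJ by (meson order_trans subsetD)
    qed
    also have "\<dots> \<le> E * (2 + log 2 (r / \<delta>)) * (M * \<delta> powr t)"
    proof (intro mult_mono)
      have "M / card X \<le> M / \<delta> powr (- t)"
        using cX \<open>0 < \<delta> powr (- t)\<close> \<open>card X > 0\<close> M by (intro divide_left_mono mult_pos_pos) auto
      then show "M / card X \<le> M * \<delta> powr t" by (simp add: powr_minus divide_inverse)
    qed (use J \<open>E \<ge> 0\<close> \<open>log 2 (r / \<delta>) \<ge> 0\<close> M in auto)
    finally show "prob (crowded \<delta> X M) \<le> E * (2 + log 2 (r / \<delta>)) * (M * \<delta> powr t)" .
    show "V \<in> crowded \<delta> X M"
      if V: "V \<in> grassmannian k" "real (cover_number (proj_image B V) (\<delta> / 2)) \<le> M" for V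
    proof -
      obtain C where C: "finite C" "card C = cover_number (proj_image B V) (\<delta> / 2)"
        "proj_image B V \<subseteq> (\<Union>c\<in>C. cball c (\<delta> / 2))"
        using cover_number_finite_cover[OF bounded_proj_image[OF B] half_gt_zero[OF \<delta>(1)]] .
      have "orth_proj (V \<times> UNIV) ` X \<subseteq> (\<Union>c\<in>C. cball c (\<delta> / 2))"
        using C(3) X(2) unfolding proj_image_def by (meson image_mono order_trans)
      then show ?thesis using V C(1,2) X(1) by (intro crowdedI[of V X C]) auto
    qed
  qed
qed

text \<open>Largeness along \<open>V0\<close> holds at arbitrarily small scales and smallness along
  \<open>V\<close> at all small scales, so the scales can be chosen from \<open>V0\<close> before
  \<open>V\<close> is known. Each \<open>V\<close> in question then lies in all but finitely many
  \<open>A i\<close>.\<close>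

lemma sigma_closed_null_upper_box_dim_less:
  fixes B :: "('a \<times> 'b::euclidean_space) set"
  assumes B: "bounded B" "B \<noteq> {}" and V0: "V0 \<in> grassmannian k" and st: "s < t"
    and t: "ereal t < upper_box_dim (proj_image B V0)"
  shows "sigma_closed_null {V \<in> grassmannian k. upper_box_dim (proj_image B V) < ereal s}"
proof -
  define E where "E = (4 * real DIM('a) * real DIM('a) + 2) ^ DIM('a) * 2 ^ k *
    (2 * real (k + DIM('b)) + 2) ^ (k + DIM('b))"
  obtain a where a: "a > 0" "\<And>x. x \<in> B \<Longrightarrow> norm x \<le> a" using B(1) by (auto simp: bounded_pos)
  define r where "r = 2 * a"
  have "r > 0" using a by (simp add: r_def)
  have r: "norm (fst (x - y)) \<le> r" if "x \<in> B" "y \<in> B" for x y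
    using norm_fst_le[of "fst (x - y)" "snd (x - y)", unfolded prod.collapse] norm_triangle_ineq4[of x y] a(2)[OF that(1)] a(2)[OF that(2)]
    by (simp add: r_def)
  \<comment> \<open>The bound at one scale for \<open>M = (\<delta> / 2) powr (- s)\<close>, which
    covers every projection of dimension below \<open>s\<close> once \<delta> is small
    enough.\<close>
  define err where "err \<delta> = E * (2 + log 2 (r / \<delta>)) * ((\<delta> / 2) powr (- s) * \<delta> powr t)" for \<delta>
  have "((\<lambda>\<delta>. (2 + log 2 r - ln \<delta> / ln 2) * \<delta> powr (t - s)) \<longlongrightarrow> 0) (at_right 0)"
    using st by real_asymp
  then have "((\<lambda>\<delta>. E * 2 powr s * ((2 + log 2 r - ln \<delta> / ln 2) * \<delta> powr (t - s))) \<longlongrightarrow> E * 2 powr s * 0) (at_right 0)"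
    by (intro tendsto_mult tendsto_const)
  moreover have "eventually (\<lambda>\<delta>. E * 2 powr s * ((2 + log 2 r - ln \<delta> / ln 2) * \<delta> powr (t - s)) = err \<delta>) (at_right 0)"
    using eventually_at_right_0_less_1
  proof eventually_elim
    case (elim \<delta>)
    have "(\<delta> / 2) powr (- s) * \<delta> powr t = 2 powr s * \<delta> powr (t - s)"
      using elim by (simp add: powr_divide powr_minus powr_diff field_simps)
    moreover have "2 + log 2 (r / \<delta>) = 2 + log 2 r - ln \<delta> / ln 2"
      using elim \<open>r > 0\<close> by (simp add: log_def ln_div diff_divide_distrib)
    ultimately show ?case by (simp add: err_def)
  qed
  ultimately have err: "(err \<longlongrightarrow> 0) (at_right 0)" using tendsto_cong by force
  \<comment> \<open>The bound 1 / (i + 1) on \<delta> forces the scales to 0, so they pass below any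
    threshold depending on \<open>V\<close>.\<close>
  have "\<exists>\<delta> A. 0 < \<delta> \<and> \<delta> < 1 / (real i + 1) \<and> closedin (grass_topology k) A \<and>
      prob A \<le> 1 / (real i + 1) \<and>
      (\<forall>V\<in>grassmannian k. real (cover_number (proj_image B V) (\<delta> / 2)) \<le> (\<delta> / 2) powr (- s) \<longrightarrow> V \<in> A)"
    for i :: nat
  proof -
    have "proj_image B V0 \<noteq> {}" using B(2) by (simp add: proj_image_def)
    from less_upper_box_dim_frequently[OF bounded_proj_image[OF B(1)] this t]
    have "frequently (\<lambda>\<delta>. \<delta> powr (- t) < real (cover_number (proj_image B V0) \<delta>)) (at_right 0)" .
    moreover have "eventually (\<lambda>\<delta>. err \<delta> < 1 / (real i + 1)) (at_right 0)"
      using err by (rule order_tendstoD) (simp add: add_nonneg_pos)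
    moreover have "eventually (\<lambda>\<delta>::real. 0 < \<delta> \<and> \<delta> < min r (1 / (real i + 1))) (at_right 0)"
      unfolding eventually_at_right_field
      using \<open>r > 0\<close> by (intro exI[of _ "min r (1 / (real i + 1))"]) (auto simp: add_nonneg_pos)
    ultimately have "frequently (\<lambda>\<delta>. \<delta> powr (- t) < real (cover_number (proj_image B V0) \<delta>) \<and>
        err \<delta> < 1 / (real i + 1) \<and> 0 < \<delta> \<and> \<delta> < min r (1 / (real i + 1))) (at_right 0)"
      by (intro frequently_eventually_frequently) (simp_all only: eventually_conj_iff simp_thms)
    then obtain \<delta> where \<delta>: "\<delta> powr (- t) < real (cover_number (proj_image B V0) \<delta>)"
      "err \<delta> < 1 / (real i + 1)" "0 < \<delta>" "\<delta> < min r (1 / (real i + 1))"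
      using frequently_ex by blast
    obtain A where A: "closedin (grass_topology k) A" "prob A \<le> err \<delta>"
      "\<And>V. V \<in> grassmannian k \<Longrightarrow> real (cover_number (proj_image B V) (\<delta> / 2)) \<le> (\<delta> / 2) powr (- s) \<Longrightarrow> V \<in> A"
      using crowded_cover_exists[OF B(1) V0 r \<delta>(3) _ _ \<delta>(1), of "(\<delta> / 2) powr (- s)"] \<delta>(3,4)
      unfolding err_def E_def by (metis half_gt_zero less_eq_real_def min_less_iff_conj order_less_irrefl powr_gt_zero)
    show ?thesis
      using \<delta> A by (intro exI[of _ \<delta>] exI[of _ A]) auto
  qed
  then obtain \<delta> A where
    \<delta>: "\<And>i. 0 < \<delta> i \<and> \<delta> i < 1 / (real i + 1)" and
    A: "\<And>i. closedin (grass_topology k) (A i)" "\<And>i. prob (A i) \<le> 1 / (real i + 1)" and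
    mem: "\<And>i V. V \<in> grassmannian k \<Longrightarrow>
      real (cover_number (proj_image B V) (\<delta> i / 2)) \<le> (\<delta> i / 2) powr (- s) \<Longrightarrow> V \<in> A i"
    by metis
  show ?thesis
    unfolding sigma_closed_null_def
  proof (intro exI[of _ "range (\<lambda>j. \<Inter>i\<in>{j..}. A i)"] conjI)
    show "\<forall>N\<in>range (\<lambda>j. \<Inter>i\<in>{j..}. A i). closed_null N"
      using closed_null_INT[of A, OF A] by blast
    show "{V \<in> grassmannian k. upper_box_dim (proj_image B V) < ereal s} \<subseteq> \<Union>(range (\<lambda>j. \<Inter>i\<in>{j..}. A i))"
    proof
      fix V assume "V \<in> {V \<in> grassmannian k. upper_box_dim (proj_image B V) < ereal s}"
      then have V: "V \<in> grassmannian k" "upper_box_dim (proj_image B V) < ereal s" by auto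
      from upper_box_dim_less_eventually[OF V(2)] obtain d where d: "d > 0"
        "\<And>\<delta>. 0 < \<delta> \<Longrightarrow> \<delta> < d \<Longrightarrow> real (cover_number (proj_image B V) \<delta>) \<le> \<delta> powr (- s)"
        unfolding eventually_at_right_field by auto
      obtain j where j: "1 / (real j + 1) < d"
        using reals_Archimedean[OF d(1)] by (auto simp: inverse_eq_divide add.commute)
      have "V \<in> A i" if "i \<ge> j" for i
      proof (rule mem[OF V(1)])
        have "1 / (real i + 1) \<le> 1 / (real j + 1)" using that by (intro divide_left_mono) auto
        then have "\<delta> i / 2 < d" "0 < \<delta> i / 2" using \<delta>[of i] j by linarith+
        then show "real (cover_number (proj_image B V) (\<delta> i / 2)) \<le> (\<delta> i / 2) powr (- s)"
          using d(2) by blast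
      qed
      then show "V \<in> \<Union>(range (\<lambda>j. \<Inter>i\<in>{j..}. A i))" by auto
    qed
  qed simp
qed

text \<open>A value below the supremum is already below \<open>D W\<close> for some
  \<open>W\<close>, and a rational separates the two; countably many sublevel sets suffice even if
  the supremum is not attained.\<close>

lemma sigma_closed_null_exceptional_set:
  assumes D: "\<And>V s t. V \<in> grassmannian k \<Longrightarrow> s < t \<Longrightarrow> ereal t < D V \<Longrightarrow>
    sigma_closed_null {V \<in> grassmannian k. D V < ereal s}"
  shows "sigma_closed_null (exceptional_set k D)"
proof -
  define Q where "Q = {q :: rat. \<exists>V t. V \<in> grassmannian k \<and> real_of_rat q < t \<and> ereal t < D V}"
  have "sigma_closed_null (\<Union>q\<in>Q. {V \<in> grassmannian k. D V < ereal (real_of_rat q)})"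
    by (rule sigma_closed_null_UN) (use D in \<open>auto simp: Q_def\<close>)
  moreover have "exceptional_set k D \<subseteq> (\<Union>q\<in>Q. {V \<in> grassmannian k. D V < ereal (real_of_rat q)})"
  proof
    fix V assume "V \<in> exceptional_set k D"
    then have V: "V \<in> grassmannian k" "D V \<noteq> (SUP W\<in>grassmannian k. D W)"
      by (auto simp: exceptional_set_def)
    then have "D V < (SUP W\<in>grassmannian k. D W)" using SUP_upper[OF V(1), of D] by (simp add: less_le)
    then obtain W where W: "W \<in> grassmannian k" "D V < D W" by (auto simp: less_SUP_iff)
    obtain q where q: "D V < ereal (real_of_rat q)" "ereal (real_of_rat q) < D W"
      using ereal_dense3[OF W(2)] by auto
    obtain t where "ereal (real_of_rat q) < ereal t" "ereal t < D W"
      using ereal_dense2[OF q(2)] by auto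
    then have "q \<in> Q" using W(1) by (auto simp: Q_def)
    then show "V \<in> (\<Union>q\<in>Q. {V \<in> grassmannian k. D V < ereal (real_of_rat q)})"
      using q(1) V(1) by blast
  qed
  ultimately show ?thesis by (rule sigma_closed_null_subset)
qed

end


section \<open>Packing dimension of projections\<close>

lemma upper_box_dim_mono_cover_number:
  assumes "\<And>\<delta>. 0 < \<delta> \<Longrightarrow> cover_number E \<delta> \<le> cover_number F \<delta>"
  shows "upper_box_dim E \<le> upper_box_dim F"
  unfolding upper_box_dim_def
proof (rule Limsup_mono)
  \<comment> \<open>This includes 0, since \<open>ln 0 = 0\<close> is at most the logarithm of every
    natural number.\<close>
  have ln_le: "ln (real i) \<le> ln (real j)" if "i \<le> j" for i j :: nat
    using that by (cases "i = 0"; cases "j = 0") auto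
  show "\<forall>\<^sub>F \<delta> in at_right 0. ereal (ln (real (cover_number E \<delta>)) / - ln \<delta>) \<le>
      ereal (ln (real (cover_number F \<delta>)) / - ln \<delta>)"
    using eventually_at_right_0_less_1
  proof eventually_elim
    case (elim \<delta>)
    then have "ln (real (cover_number E \<delta>)) / - ln \<delta> \<le> ln (real (cover_number F \<delta>)) / - ln \<delta>"
      using assms by (intro divide_right_mono ln_le) auto
    then show ?case by simp
  qed
qed

lemma upper_box_dim_mono:
  fixes E F :: "'c::euclidean_space set"
  shows "E \<subseteq> F \<Longrightarrow> bounded F \<Longrightarrow> upper_box_dim E \<le> upper_box_dim F"
  by (intro upper_box_dim_mono_cover_number cover_number_mono)

text \<open>A finite union of closed balls is closed, so it covers the closure too. Hence the pieces
  of a packing cover may be replaced by closed sets, as Baire's theorem requires.\<close>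

lemma upper_box_dim_closure_le:
  fixes F :: "'c::euclidean_space set"
  assumes "bounded F"
  shows "upper_box_dim (closure F) \<le> upper_box_dim F"
proof (rule upper_box_dim_mono_cover_number)
  fix \<delta> :: real assume "0 < \<delta>"
  obtain C where C: "finite C" "card C = cover_number F \<delta>" "F \<subseteq> (\<Union>c\<in>C. cball c \<delta>)"
    using cover_number_finite_cover[OF assms \<open>0 < \<delta>\<close>] .
  have "closure F \<subseteq> (\<Union>c\<in>C. cball c \<delta>)"
    using C(1,3) by (intro closure_minimal closed_UN) auto
  then show "cover_number (closure F) \<delta> \<le> cover_number F \<delta>"
    using cover_number_le_card[OF C(1)] C(2) by simp
qed

text \<open>A countable family replaces the sequence in \<open>packing_dim\<close>, so that the
  empty family is allowed and countable unions are immediate.\<close>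

definition covered_by_dim_le :: "real \<Rightarrow> 'c::euclidean_space set \<Rightarrow> bool" where
  "covered_by_dim_le t E \<longleftrightarrow>
     (\<exists>\<F>. countable \<F> \<and> (\<forall>F\<in>\<F>. bounded F \<and> upper_box_dim F \<le> ereal t) \<and> E \<subseteq> \<Union>\<F>)"

lemma covered_by_dim_le_UN:
  assumes "countable I" "\<And>i. i \<in> I \<Longrightarrow> covered_by_dim_le t (E i)" "D \<subseteq> (\<Union>i\<in>I. E i)"
  shows "covered_by_dim_le t D"
proof -
  from assms(2) obtain \<F> where \<F>: "\<And>i. i \<in> I \<Longrightarrow> countable (\<F> i) \<and>
      (\<forall>F\<in>\<F> i. bounded F \<and> upper_box_dim F \<le> ereal t) \<and> E i \<subseteq> \<Union>(\<F> i)"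
    unfolding covered_by_dim_le_def by metis
  show ?thesis
    unfolding covered_by_dim_le_def
  proof (intro exI[of _ "\<Union>i\<in>I. \<F> i"] conjI)
    show "countable (\<Union>i\<in>I. \<F> i)" using assms(1) \<F> by (intro countable_UN) auto
    show "\<forall>F\<in>\<Union>i\<in>I. \<F> i. bounded F \<and> upper_box_dim F \<le> ereal t" using \<F> by blast
    have "(\<Union>i\<in>I. E i) \<subseteq> \<Union>(\<Union>i\<in>I. \<F> i)"
    proof (rule UN_least)
      fix i assume i: "i \<in> I"
      have "\<Union>(\<F> i) \<subseteq> \<Union>(\<Union>i\<in>I. \<F> i)" using i by (intro Union_mono UN_upper)
      then show "E i \<subseteq> \<Union>(\<Union>i\<in>I. \<F> i)" using \<F>[OF i] by (meson order_trans)
    qed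
    then show "D \<subseteq> \<Union>(\<Union>i\<in>I. \<F> i)" by (rule order_trans[OF assms(3)])
  qed
qed

lemma packing_dim_le_of_covered:
  assumes "covered_by_dim_le t E" "E \<noteq> {}"
  shows "packing_dim E \<le> ereal t"
proof -
  from assms(1) obtain \<F> where \<F>: "countable \<F>" "\<And>F. F \<in> \<F> \<Longrightarrow> bounded F \<and> upper_box_dim F \<le> ereal t"
    "E \<subseteq> \<Union>\<F>"
    unfolding covered_by_dim_le_def by auto
  have "\<F> \<noteq> {}" using \<F>(3) assms(2) by auto
  then have F: "from_nat_into \<F> j \<in> \<F>" for j by (rule from_nat_into)
  have "packing_dim E \<le> (SUP j. upper_box_dim (from_nat_into \<F> j))"
    unfolding packing_dim_def
  proof (rule Inf_lower, rule CollectI, rule exI[of _ "from_nat_into \<F>"], intro conjI allI refl)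
    show "bounded (from_nat_into \<F> j)" for j using F \<F>(2) by blast
    show "E \<subseteq> (\<Union>j. from_nat_into \<F> j)"
      using \<F>(3) range_from_nat_into[OF \<open>\<F> \<noteq> {}\<close> \<F>(1)] by simp
  qed
  also have "\<dots> \<le> ereal t" using F \<F>(2) by (intro SUP_least) blast
  finally show ?thesis .
qed

lemma packing_dim_less_cover:
  assumes "packing_dim E < s"
  obtains F :: "nat \<Rightarrow> 'c::metric_space set"
  where "\<And>j. bounded (F j)" "\<And>j. upper_box_dim (F j) < s" "E \<subseteq> (\<Union>j. F j)"
proof -
  from assms obtain F :: "nat \<Rightarrow> 'c set" where F: "\<forall>j. bounded (F j)" "E \<subseteq> (\<Union>j. F j)"
    "(SUP j. upper_box_dim (F j)) < s"
    unfolding packing_dim_def Inf_less_iff by auto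
  have "upper_box_dim (F j) < s" for j
    using SUP_upper[of j UNIV "\<lambda>j. upper_box_dim (F j)"] F(3) by (meson UNIV_I order_le_less_trans)
  with F that show thesis by blast
qed

section \<open>Baire category in closed subsets of the Baire space\<close>

lemma completely_metrizable_closed_Baire_space:
  fixes Z :: "(nat \<Rightarrow> nat) set"
  assumes "closed Z"
  shows "completely_metrizable_space (top_of_set Z)"
proof -
  have "(euclidean :: nat topology) = discrete_topology UNIV"
    by (simp add: topology_eq open_discrete flip: open_openin)
  then have "completely_metrizable_space (euclidean :: (nat \<Rightarrow> nat) topology)"
    by (simp add: completely_metrizable_space_product_topology completely_metrizable_space_discrete_topology
        flip: euclidean_product_topology)
  then show ?thesis
    using assms by (intro completely_metrizable_space_closedin) simp_all
qed

text \<open>If every \<open>Z \<inter> C i\<close> had empty relative interior, so would their union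
  by Baire's theorem, but this union is the whole nonempty space \<open>Z\<close>.\<close>

lemma Baire_countable_closed_cover:
  fixes Z :: "(nat \<Rightarrow> nat) set"
  assumes Z: "closed Z" "Z \<noteq> {}" and C: "countable I" "\<And>i. i \<in> I \<Longrightarrow> closed (C i)" "Z \<subseteq> (\<Union>i\<in>I. C i)"
  obtains i W where "i \<in> I" "open W" "W \<inter> Z \<noteq> {}" "W \<inter> Z \<subseteq> C i"
proof -
  have "\<exists>i\<in>I. top_of_set Z interior_of (Z \<inter> C i) \<noteq> {}"
  proof (rule ccontr)
    assume neg: "\<not> ?thesis"
    have "top_of_set Z interior_of \<Union>((\<lambda>i. Z \<inter> C i) ` I) = {}"
    proof (rule Baire_category_alt)
      show "completely_metrizable_space (top_of_set Z) \<or>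
          locally_compact_space (top_of_set Z) \<and> regular_space (top_of_set Z)"
        using completely_metrizable_closed_Baire_space[OF Z(1)] by blast
      show "countable ((\<lambda>i. Z \<inter> C i) ` I)" using C(1) by simp
      show "closedin (top_of_set Z) T \<and> top_of_set Z interior_of T = {}"
        if "T \<in> (\<lambda>i. Z \<inter> C i) ` I" for T
        using that neg C(2) by (auto intro: closedin_closed_Int)
    qed
    moreover have "\<Union>((\<lambda>i. Z \<inter> C i) ` I) = topspace (top_of_set Z)" using C(3) by auto
    ultimately show False using Z(2) by (simp only: interior_of_topspace) simp
  qed
  then obtain i where i: "i \<in> I" "top_of_set Z interior_of (Z \<inter> C i) \<noteq> {}" by blast
  have "openin (top_of_set Z) (top_of_set Z interior_of (Z \<inter> C i))" by (rule openin_interior_of)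
  then obtain W where W: "open W" "top_of_set Z interior_of (Z \<inter> C i) = Z \<inter> W"
    unfolding openin_open by (elim exE conjE)
  have "Z \<inter> W \<subseteq> Z \<inter> C i" unfolding W(2)[symmetric] by (rule interior_of_subset)
  then show thesis using i W by (intro that[OF i(1) W(1)]) auto
qed

context grassmannian_measure
begin

text \<open>
  The closed set \<open>Z\<close> arises from the Baire space by deleting every basic open set whose image
  projects into countably many bounded sets of dimension at most \<open>t\<close> along \<open>V0\<close>. If \<open>V\<close> has a
  cover showing dimension less than \<open>s\<close>, then Baire's theorem puts the image of a whole relatively
  open piece of \<open>Z\<close> into one member of this cover, and the box-dimension statement applies to
  that piece.
\<close>

lemma sigma_closed_null_packing_dim_less:
  fixes f :: "(nat \<Rightarrow> nat) \<Rightarrow> 'a \<times> 'b::euclidean_space"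
  assumes f: "continuous_on UNIV f" and V0: "V0 \<in> grassmannian k" and st: "s < t"
    and t: "ereal t < packing_dim (proj_image (range f) V0)"
  shows "sigma_closed_null {V \<in> grassmannian k. packing_dim (proj_image (range f) V) < ereal s}"
proof -
  obtain \<B> :: "(nat \<Rightarrow> nat) set set" where \<B>: "countable \<B>" "topological_basis \<B>"
    using ex_countable_basis by blast
  define small where "small U \<longleftrightarrow> covered_by_dim_le t (proj_image (f ` U) V0)" for U
  define Z where "Z = - \<Union>{U \<in> \<B>. small U}"
  have "closed Z"
    unfolding Z_def using topological_basis_open[OF \<B>(2)] by (intro closed_Compl open_Union) auto
  have small_UN: "small U" if "countable I" "\<And>i. i \<in> I \<Longrightarrow> small (W i)" "U \<subseteq> (\<Union>i\<in>I. W i)"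
    for U W and I :: "(nat \<Rightarrow> nat) set set"
    unfolding small_def
  proof (rule covered_by_dim_le_UN[OF that(1)])
    show "covered_by_dim_le t (proj_image (f ` W i) V0)" if "i \<in> I" for i
      using \<open>\<And>i. i \<in> I \<Longrightarrow> small (W i)\<close>[OF that] by (simp add: small_def)
    have "proj_image (f ` U) V0 \<subseteq> proj_image (f ` (\<Union>i\<in>I. W i)) V0"
      unfolding proj_image_def using that(3) by (intro image_mono)
    then show "proj_image (f ` U) V0 \<subseteq> (\<Union>i\<in>I. proj_image (f ` W i) V0)"
      by (simp add: proj_image_def image_UN)
  qed
  have cs: "countable {U \<in> \<B>. small U}" using \<B>(1) by (rule countable_subset[rotated]) auto
  \<comment> \<open>If \<open>U \<inter> Z\<close> were small, it and the countably many deleted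
    sets would cover \<open>U\<close>; then \<open>U\<close> would be small and hence itself
    deleted.\<close>
  have not_small: "\<not> small (U \<inter> Z)" if U: "U \<in> \<B>" "U \<inter> Z \<noteq> {}" for U
  proof
    assume "small (U \<inter> Z)"
    have "small U"
    proof (rule small_UN)
      show "countable (insert (U \<inter> Z) {U \<in> \<B>. small U})" using cs by simp
      show "small W" if "W \<in> insert (U \<inter> Z) {U \<in> \<B>. small U}" for W
        using that \<open>small (U \<inter> Z)\<close> by auto
      show "U \<subseteq> (\<Union>W\<in>insert (U \<inter> Z) {U \<in> \<B>. small U}. W)" by (auto simp: Z_def)
    qed
    then have "U \<inter> Z = {}" using U(1) by (auto simp: Z_def)
    then show False using U(2) by simp
  qed
  have "Z \<noteq> {}"
  proof
    assume "Z = {}"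
    have "small UNIV"
      by (rule small_UN[OF cs, of "\<lambda>W. W"]) (use \<open>Z = {}\<close> in \<open>auto simp: Z_def\<close>)
    then have "packing_dim (proj_image (range f) V0) \<le> ereal t"
      unfolding small_def by (intro packing_dim_le_of_covered) (simp_all add: proj_image_def)
    then show False using t by simp
  qed
  \<comment> \<open>The box dimension result needs bounded sets; these countably many pieces serve
    all \<open>V\<close> at once.\<close>
  define \<U> where "\<U> = {U \<in> \<B>. U \<inter> Z \<noteq> {} \<and> bounded (f ` (U \<inter> Z))}"
  have "countable \<U>" unfolding \<U>_def using \<B>(1) by (rule countable_subset[rotated]) auto
  have "sigma_closed_null
      (\<Union>U\<in>\<U>. {V \<in> grassmannian k. upper_box_dim (proj_image (f ` (U \<inter> Z)) V) < ereal s})"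
  proof (rule sigma_closed_null_UN[OF \<open>countable \<U>\<close>])
    fix U assume "U \<in> \<U>"
    then have U: "U \<in> \<B>" "U \<inter> Z \<noteq> {}" "bounded (f ` (U \<inter> Z))" by (auto simp: \<U>_def)
    \<comment> \<open>Otherwise the projection along \<open>V0\<close>, as a cover of itself by one
      bounded set, would make the piece small.\<close>
    have "\<not> upper_box_dim (proj_image (f ` (U \<inter> Z)) V0) \<le> ereal t"
    proof
      assume "upper_box_dim (proj_image (f ` (U \<inter> Z)) V0) \<le> ereal t"
      then have "small (U \<inter> Z)"
        unfolding small_def covered_by_dim_le_def
        by (intro exI[of _ "{proj_image (f ` (U \<inter> Z)) V0}"]) (simp add: bounded_proj_image U(3))
      then show False using not_small U by blast
    qed
    then show "sigma_closed_null {V \<in> grassmannian k. upper_box_dim (proj_image (f ` (U \<inter> Z)) V) < ereal s}"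
      using U(2,3) V0 st by (intro sigma_closed_null_upper_box_dim_less[of _ V0 s t]) auto
  qed
  moreover have "{V \<in> grassmannian k. packing_dim (proj_image (range f) V) < ereal s} \<subseteq>
      (\<Union>U\<in>\<U>. {V \<in> grassmannian k. upper_box_dim (proj_image (f ` (U \<inter> Z)) V) < ereal s})"
  proof
    fix V assume "V \<in> {V \<in> grassmannian k. packing_dim (proj_image (range f) V) < ereal s}"
    then have V: "V \<in> grassmannian k" "packing_dim (proj_image (range f) V) < ereal s" by auto
    let ?\<pi> = "orth_proj (V \<times> (UNIV :: 'b set))"
    obtain F :: "nat \<Rightarrow> ('a \<times> 'b) set" where F: "\<And>j. bounded (F j)"
      "\<And>j. upper_box_dim (F j) < ereal s" "proj_image (range f) V \<subseteq> (\<Union>j. F j)"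
      using packing_dim_less_cover[OF V(2)] by metis
    \<comment> \<open>Closures make these sets closed without raising the box dimension; the second
      condition makes the image of a piece bounded even if \<open>range f\<close> is not.\<close>
    define C where "C p = {x. ?\<pi> (f x) \<in> closure (F (fst p)) \<and> f x \<in> cball 0 (real (snd p))}"
      for p :: "nat \<times> nat"
    have cont: "continuous_on UNIV (\<lambda>x. ?\<pi> (f x))"
      using continuous_on_compose2[OF linear_continuous_on f, of ?\<pi> UNIV] linear_orth_proj[of "V \<times> (UNIV :: 'b set)"]
      by (simp add: linear_conv_bounded_linear)
    have closed_C: "closed (C p)" if "p \<in> UNIV" for p
      unfolding C_def
      using closed_vimage_Int[of "closure (F (fst p))" UNIV "\<lambda>x. ?\<pi> (f x)"] cont
        closed_vimage_Int[of "cball 0 (real (snd p))" UNIV f] f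
      by (auto simp: vimage_def Collect_conj_eq)
    have cover_C: "Z \<subseteq> (\<Union>p\<in>UNIV. C p)"
    proof
      fix x
      have "?\<pi> (f x) \<in> proj_image (range f) V" by (simp add: proj_image_def)
      then obtain j where "?\<pi> (f x) \<in> F j" using subsetD[OF F(3)] by blast
      then have "?\<pi> (f x) \<in> closure (F j)" by (rule subsetD[OF closure_subset])
      moreover obtain i where "norm (f x) \<le> real i" using real_arch_simple by blast
      ultimately have "x \<in> C (j, i)" by (simp add: C_def)
      then show "x \<in> (\<Union>p\<in>UNIV. C p)" by blast
    qed
    obtain p W where "p \<in> UNIV" and W: "open W" "W \<inter> Z \<noteq> {}" "W \<inter> Z \<subseteq> C p"
      using Baire_countable_closed_cover[OF \<open>closed Z\<close> \<open>Z \<noteq> {}\<close> countableI_type closed_C cover_C] .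
    then obtain x where x: "x \<in> W" "x \<in> Z" by blast
    obtain U where U: "U \<in> \<B>" "x \<in> U" "U \<subseteq> W"
      using topological_basisE[OF \<B>(2) W(1) x(1)] .
    have UC: "U \<inter> Z \<subseteq> C p" using U(3) W(3) by blast
    have "f ` (U \<inter> Z) \<subseteq> cball 0 (real (snd p))" using UC by (auto simp: C_def)
    then have "bounded (f ` (U \<inter> Z))" by (rule bounded_subset[OF bounded_cball])
    then have "U \<in> \<U>" using U x by (auto simp: \<U>_def)
    have "proj_image (f ` (U \<inter> Z)) V \<subseteq> closure (F (fst p))"
      using UC by (auto simp: C_def proj_image_def)
    then have "upper_box_dim (proj_image (f ` (U \<inter> Z)) V) \<le> upper_box_dim (closure (F (fst p)))"
      using F(1) by (intro upper_box_dim_mono bounded_closure)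
    also have "\<dots> \<le> upper_box_dim (F (fst p))" using F(1) by (rule upper_box_dim_closure_le)
    also have "\<dots> < ereal s" by (rule F(2))
    finally show "V \<in> (\<Union>U\<in>\<U>. {V \<in> grassmannian k. upper_box_dim (proj_image (f ` (U \<inter> Z)) V) < ereal s})"
      using \<open>U \<in> \<U>\<close> V(1) by blast
  qed
  ultimately show ?thesis by (rule sigma_closed_null_subset)
qed

end


section \<open>The exceptional sets\<close>

theorem theorem1p4:
  fixes B :: "((real ^ 'p) \<times> (real ^ 'l)) set"
    and l m n :: nat
    and \<gamma> :: "(real ^ 'p) set measure"
  assumes l: "l = CARD('l)"
    and n: "n = CARD('p) + CARD('l)"
    and "0 < l" "l < m" "m < n"
    and \<gamma>: "invariant_grass_measure (m - l) \<gamma>"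
    and B: "analytic_set B"
  defines "E\<^sub>B \<equiv> exceptional_set (m - l) (\<lambda>V. upper_box_dim (proj_image B V))"
    and "E\<^sub>p \<equiv> exceptional_set (m - l) (\<lambda>V. packing_dim (proj_image B V))"
  shows "(bounded B \<longrightarrow>
            meagre_in (grass_topology (m - l)) E\<^sub>B \<and> E\<^sub>B \<in> null_sets (completion \<gamma>)) \<and>
         meagre_in (grass_topology (m - l)) E\<^sub>p \<and> E\<^sub>p \<in> null_sets (completion \<gamma>)"
proof -
  interpret grassmannian_measure "m - l" \<gamma> by standard (rule \<gamma>)
  have box: "sigma_closed_null E\<^sub>B" if "bounded B"
    unfolding E\<^sub>B_def
  proof (rule sigma_closed_null_exceptional_set)
    fix V :: "(real ^ 'p) set" and s t :: real
    assume V: "V \<in> grassmannian (m - l)" and st: "s < t"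
      and t: "ereal t < upper_box_dim (proj_image B V)"
    show "sigma_closed_null {W \<in> grassmannian (m - l). upper_box_dim (proj_image B W) < ereal s}"
    \<comment> \<open>All projections of the empty set coincide, so no \<open>W\<close> has
      dimension below \<open>s\<close> when \<open>V\<close> has dimension above
      \<open>t\<close>.\<close>
    proof (cases "B = {}")
      case True
      have "\<not> upper_box_dim (proj_image B W) < ereal s" for W
        using t st unfolding True proj_image_def by (simp add: not_less) (meson ereal_less_eq(3) less_imp_le order_trans)
      then show ?thesis by (simp add: sigma_closed_null_empty)
    qed (rule sigma_closed_null_upper_box_dim_less[OF that _ V st t])
  qed
  have packing: "sigma_closed_null E\<^sub>p"
    unfolding E\<^sub>p_def
  proof (rule sigma_closed_null_exceptional_set)
    fix V :: "(real ^ 'p) set" and s t :: real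
    assume V: "V \<in> grassmannian (m - l)" and st: "s < t"
      and t: "ereal t < packing_dim (proj_image B V)"
    show "sigma_closed_null {W \<in> grassmannian (m - l). packing_dim (proj_image B W) < ereal s}"
    proof (cases "B = {}")
      case True
      have "\<not> packing_dim (proj_image B W) < ereal s" for W
        using t st unfolding True proj_image_def by (simp add: not_less) (meson ereal_less_eq(3) less_imp_le order_trans)
      then show ?thesis by (simp add: sigma_closed_null_empty)
    next
      case False
      then obtain f :: "(nat \<Rightarrow> nat) \<Rightarrow> (real ^ 'p) \<times> (real ^ 'l)"
        where f: "continuous_on UNIV f" "B = range f"
        using B by (auto simp: analytic_set_def)
      show ?thesis
        unfolding f(2) by (rule sigma_closed_null_packing_dim_less[OF f(1) V st t[unfolded f(2)]])
    qed
  qed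
  show ?thesis
    using box packing sigma_closed_null_meagre sigma_closed_null_null_sets by blast
qed

end
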